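(* (1) Let $\chi=0$ or $\chi=e$ and $\Phi(c)=c^p-2c^{(p+1)/2}+c\in k[c]$. Set $\pi_0=\Phi(c)/c$ and, for each nonzero quadratic residue $\alpha$ modulo $p$ (viewed in $\mathbb{F}_p\subset k$), $\pi_\alpha=\frac{2(c+\alpha)\Phi(c)}{(c-\alpha)^2}$; these are polynomials in $k[c]$. Their images in $\mathcal{U}_\chi(\mathfrak{sl}_2)$ are central idempotents and \[\mathcal{U}_\chi(\mathfrak{sl}_2)=\bigoplus_{\alpha\in\mathbb{F}_p,\ \left(\frac{\alpha}{p}\right)\neq-1}\pi_\alpha\,\mathcal{U}_\chi(\mathfrak{sl}_2)\] is the block decomposition, $\pi_\alpha\mathcal{U}_\chi(\mathfrak{sl}_2)$ being the block on whose simple modules $c$ acts by $\alpha$. (2) Let $\chi=ah/2$ with $a\in k^\times$ and $\Phi_a(c)=c^p-2c^{(p+1)/2}+c-a^2$. For each root $\alpha$ of $\Phi_a$ set $\pi_\alpha=\kappa_\alpha\frac{\Phi_a(c)}{c-\alpha}\in k[c]$, where $\kappa_\alpha\in k$ is the constant making $\pi_\alpha(\alpha)=1$. Then the images of the $\pi_\alpha$ in $\mathcal{U}_\chi(\mathfrak{sl}_2)$ are central idempotents and $\mathcal{U}_\chi(\mathfrak{sl}_2)=\bigoplus_{\Phi_a(\alpha)=0}\pi_\alpha\mathcal{U}_\chi(\mathfrak{sl}_2)$ is the block decomposition, $\pi_\alpha\mathcal{U}_\chi(\mathfrak{sl}_2)$ being the block on whose simple modules $c$ acts by $\alpha$.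
   Context: Let $k$ be an algebraically closed field of characteristic $p>2$ and $\mathfrak{sl}_2=\mathfrak{sl}_2(k)$ with standard basis $e,f,h$ ($[e,f]=h$, $[h,e]=2e$, $[h,f]=-2f$). $\mathcal{U}_0(\mathfrak{sl}_2)=\mathcal{U}(\mathfrak{sl}_2)/\langle e^p,f^p,h^p-h\rangle$, $\mathcal{U}_e(\mathfrak{sl}_2)=\mathcal{U}(\mathfrak{sl}_2)/\langle e^p,f^p-1,h^p-h\rangle$, $\mathcal{U}_{ah/2}(\mathfrak{sl}_2)=\mathcal{U}(\mathfrak{sl}_2)/\langle e^p,f^p,h^p-h-a\rangle$. $c=(h-1)^2+4ef$ is central in $\mathcal{U}(\mathfrak{sl}_2)$ and its image is denoted again by $c$. The block decomposition of a finite-dimensional algebra is its decomposition into indecomposable two-sided ideals (blocks), equivalently the decomposition of its module category by linkage of simple modules; $c$ acts by a scalar on every simple module of a given block. *)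

theory Defs
  imports "HOL-Computational_Algebra.Polynomial" "HOL-Number_Theory.Residues"
    "Jordan_Normal_Form.Matrix"
begin

datatype gen = Ge | Gf | Gh

text \<open>Elements of the free associative algebra k<e,f,h>: coefficient functions on words
  (with finite support, see FA).\<close>
type_synonym 'k fa = "gen list \<Rightarrow> 'k"

definition FA :: "('k::field) fa set" where
  "FA = {x. finite {w. x w \<noteq> 0}}"

definition fa_zero :: "('k::field) fa" where "fa_zero = (\<lambda>w. 0)"
definition fa_one :: "('k::field) fa" where "fa_one = (\<lambda>w. if w = [] then 1 else 0)"
definition fa_gen :: "gen \<Rightarrow> ('k::field) fa" where "fa_gen g = (\<lambda>w. if w = [g] then 1 else 0)"
definition fa_add :: "('k::field) fa \<Rightarrow> 'k fa \<Rightarrow> 'k fa" where "fa_add x y = (\<lambda>w. x w + y w)"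
definition fa_sub :: "('k::field) fa \<Rightarrow> 'k fa \<Rightarrow> 'k fa" where "fa_sub x y = (\<lambda>w. x w - y w)"
definition fa_smult :: "'k::field \<Rightarrow> 'k fa \<Rightarrow> 'k fa" where "fa_smult a x = (\<lambda>w. a * x w)"
definition fa_mult :: "('k::field) fa \<Rightarrow> 'k fa \<Rightarrow> 'k fa" where
  "fa_mult x y = (\<lambda>w. \<Sum>i\<le>length w. x (take i w) * y (drop i w))"
definition fa_const :: "'k::field \<Rightarrow> 'k fa" where "fa_const a = fa_smult a fa_one"

primrec fa_pow :: "('k::field) fa \<Rightarrow> nat \<Rightarrow> 'k fa" where
  "fa_pow x 0 = fa_one"
| "fa_pow x (Suc n) = fa_mult x (fa_pow x n)"

definition fa_setsum :: "'a set \<Rightarrow> ('a \<Rightarrow> ('k::field) fa) \<Rightarrow> 'k fa" where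
  "fa_setsum S g = (\<lambda>w. \<Sum>a\<in>S. g a w)"

abbreviation "E \<equiv> fa_gen Ge"
abbreviation "F \<equiv> fa_gen Gf"
abbreviation "H \<equiv> fa_gen Gh"

definition casimir :: "('k::field) fa" where
  "casimir = fa_add (fa_pow (fa_sub H fa_one) 2) (fa_smult 4 (fa_mult E F))"

definition fa_of_poly :: "('k::field) poly \<Rightarrow> 'k fa" where
  "fa_of_poly q = fa_setsum {..degree q} (\<lambda>i. fa_smult (Polynomial.coeff q i) (fa_pow casimir i))"

inductive_set ideal_gen :: "('k::field) fa set \<Rightarrow> 'k fa set" for R where
  zero: "fa_zero \<in> ideal_gen R"
| gen: "r \<in> R \<Longrightarrow> a \<in> FA \<Longrightarrow> b \<in> FA \<Longrightarrow> fa_mult (fa_mult a r) b \<in> ideal_gen R"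
| add: "x \<in> ideal_gen R \<Longrightarrow> y \<in> ideal_gen R \<Longrightarrow> fa_add x y \<in> ideal_gen R"

text \<open>Defining relations of U(sl_2) together with e^p = 0, f^p = t, h^p - h = s.
  U_0: s = 0, t = 0;  U_e: s = 0, t = 1;  U_{ah/2}: s = a, t = 0.\<close>
definition sl2_rels :: "nat \<Rightarrow> 'k::field \<Rightarrow> 'k \<Rightarrow> 'k fa set" where
  "sl2_rels p s t =
    { fa_sub (fa_sub (fa_mult E F) (fa_mult F E)) H,
      fa_sub (fa_sub (fa_mult H E) (fa_mult E H)) (fa_smult 2 E),
      fa_add (fa_sub (fa_mult H F) (fa_mult F H)) (fa_smult 2 F),
      fa_pow E p,
      fa_sub (fa_pow F p) (fa_const t),
      fa_sub (fa_sub (fa_pow H p) H) (fa_const s) }"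

definition fa_eq :: "('k::field) fa set \<Rightarrow> 'k fa \<Rightarrow> 'k fa \<Rightarrow> bool" where
  "fa_eq R x y \<longleftrightarrow> fa_sub x y \<in> ideal_gen R"

definition central_idem :: "('k::field) fa set \<Rightarrow> 'k fa \<Rightarrow> bool" where
  "central_idem R z \<longleftrightarrow> z \<in> FA \<and> (\<forall>x\<in>FA. fa_eq R (fa_mult z x) (fa_mult x z))
     \<and> fa_eq R (fa_mult z z) z"

text \<open>Two-sided ideals of FA; those containing ideal_gen R correspond to the two-sided
  ideals of the quotient algebra.\<close>
definition fa_ideal :: "('k::field) fa set \<Rightarrow> bool" where
  "fa_ideal J \<longleftrightarrow> J \<subseteq> FA \<and> fa_zero \<in> J \<and> (\<forall>x\<in>J. \<forall>y\<in>J. fa_add x y \<in> J)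
     \<and> (\<forall>x\<in>J. \<forall>a\<in>FA. fa_mult a x \<in> J \<and> fa_mult x a \<in> J)"

text \<open>Preimage in FA of the two-sided ideal z U of the quotient.\<close>
definition principal_ideal :: "('k::field) fa set \<Rightarrow> 'k fa \<Rightarrow> 'k fa set" where
  "principal_ideal R z = {x \<in> FA. \<exists>y\<in>FA. fa_eq R x (fa_mult z y)}"

definition is_block :: "('k::field) fa set \<Rightarrow> 'k fa \<Rightarrow> bool" where
  "is_block R z \<longleftrightarrow> z \<notin> ideal_gen R \<and>
     (\<forall>J1 J2. fa_ideal J1 \<and> fa_ideal J2 \<and> ideal_gen R \<subseteq> J1 \<and> ideal_gen R \<subseteq> J2
        \<and> J1 \<inter> J2 = ideal_gen R \<and> {fa_add x y | x y. x \<in> J1 \<and> y \<in> J2} = principal_ideal R z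
        \<longrightarrow> J1 = ideal_gen R \<or> J2 = ideal_gen R)"

primrec word_mat :: "nat \<Rightarrow> (gen \<Rightarrow> ('k::field) mat) \<Rightarrow> gen list \<Rightarrow> 'k mat" where
  "word_mat n \<rho> [] = 1\<^sub>m n"
| "word_mat n \<rho> (g # w) = \<rho> g * word_mat n \<rho> w"

definition fa_act :: "nat \<Rightarrow> (gen \<Rightarrow> ('k::field) mat) \<Rightarrow> 'k fa \<Rightarrow> 'k mat" where
  "fa_act n \<rho> x = mat n n (\<lambda>(i,j). \<Sum>w\<in>{w. x w \<noteq> 0}. x w * word_mat n \<rho> w $$ (i,j))"

definition invariant_subspace :: "nat \<Rightarrow> (gen \<Rightarrow> ('k::field) mat) \<Rightarrow> 'k vec set \<Rightarrow> bool" where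
  "invariant_subspace n \<rho> W \<longleftrightarrow> W \<subseteq> carrier_vec n \<and> 0\<^sub>v n \<in> W
     \<and> (\<forall>v\<in>W. \<forall>u\<in>W. v + u \<in> W) \<and> (\<forall>a. \<forall>v\<in>W. a \<cdot>\<^sub>v v \<in> W)
     \<and> (\<forall>g. \<forall>v\<in>W. \<rho> g *\<^sub>v v \<in> W)"

definition simple_module :: "('k::field) fa set \<Rightarrow> nat \<Rightarrow> (gen \<Rightarrow> 'k mat) \<Rightarrow> bool" where
  "simple_module R n \<rho> \<longleftrightarrow> n > 0 \<and> (\<forall>g. \<rho> g \<in> carrier_mat n n)
     \<and> (\<forall>r\<in>R. fa_act n \<rho> r = 0\<^sub>m n n)
     \<and> (\<forall>W. invariant_subspace n \<rho> W \<longrightarrow> W = {0\<^sub>v n} \<or> W = carrier_vec n)"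

definition is_block_decomposition ::
  "('k::field) fa set \<Rightarrow> 'k set \<Rightarrow> ('k \<Rightarrow> 'k fa) \<Rightarrow> bool" where
  "is_block_decomposition R S \<pi> \<longleftrightarrow> finite S
     \<and> (\<forall>\<alpha>\<in>S. central_idem R (\<pi> \<alpha>))
     \<and> (\<forall>\<alpha>\<in>S. \<forall>\<beta>\<in>S. \<alpha> \<noteq> \<beta> \<longrightarrow> fa_eq R (fa_mult (\<pi> \<alpha>) (\<pi> \<beta>)) fa_zero)
     \<and> fa_eq R (fa_setsum S \<pi>) fa_one
     \<and> (\<forall>\<alpha>\<in>S. is_block R (\<pi> \<alpha>))
     \<and> (\<forall>\<alpha>\<in>S. \<forall>n \<rho>. simple_module R n \<rho> \<and> fa_act n \<rho> (\<pi> \<alpha>) \<noteq> 0\<^sub>m n n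
            \<longrightarrow> fa_act n \<rho> casimir = \<alpha> \<cdot>\<^sub>m 1\<^sub>m n)"

definition alg_closed :: "'k::field itself \<Rightarrow> bool" where
  "alg_closed _ \<longleftrightarrow> (\<forall>q::'k poly. degree q > 0 \<longrightarrow> (\<exists>x. poly q x = 0))"

definition Phi :: "nat \<Rightarrow> ('k::field) poly" where
  "Phi p = Polynomial.monom 1 p - Polynomial.monom 2 ((p + 1) div 2) + Polynomial.monom 1 1"

definition Phi_a :: "nat \<Rightarrow> 'k::field \<Rightarrow> 'k poly" where
  "Phi_a p a = Phi p - [:a ^ 2:]"

definition qr_index :: "nat \<Rightarrow> ('k::field) set" where
  "qr_index p = {of_int m | m. 0 \<le> m \<and> m < int p \<and> Legendre m (int p) \<noteq> -1}"

definition pi_res :: "nat \<Rightarrow> 'k::field \<Rightarrow> 'k poly" where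
  "pi_res p \<alpha> = (if \<alpha> = 0 then Phi p div [:0, 1:]
     else (Polynomial.smult 2 ([:\<alpha>, 1:] * Phi p)) div ([:-\<alpha>, 1:] ^ 2))"

definition pi_a :: "nat \<Rightarrow> 'k::field \<Rightarrow> 'k \<Rightarrow> 'k poly" where
  "pi_a p a \<alpha> = Polynomial.smult (inverse (poly (Phi_a p a div [:-\<alpha>, 1:]) \<alpha>)) (Phi_a p a div [:-\<alpha>, 1:])"

end

theory Submission
  imports Defs
begin

text \<open>
  Moving $f$'s to the left in $e^p f^p$ gives $4^p e^p f^p = \<Prod>_j (c - (h - 1 - 2j)^2)$, which in
  characteristic $p$ equals $\<Phi>(c) - (h^p - h)^2$; hence $\<Phi>(c) = s^2$ when $e^p = 0$ and $h^p - h = s$.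
  The polynomials $\<pi>_\<alpha>$ are the Chinese remainder idempotents modulo $\<Phi> - s^2$.

  Suppose a block $\<pi>_\<alpha> U$ splits as $J_1 \<oplus> J_2$ and let $x_1$ be the component of $\<pi>_\<alpha>$ in $J_1$. Every
  nonzero left ideal contains a highest weight vector, and its weight $l$ satisfies $(l+1)^2 = \<alpha>$ inside
  the block. The central element $x_1$ acts by a scalar on the baby Verma module of each weight, namely
  by 1 for a weight occurring in $J_1$ and by 0 for one occurring in $J_2$. So the two
  weights are distinct, which forces $s = 0$ and $l_1 + 1 = m$ in the prime field; but then $f^m$ maps
  the baby Verma module of weight $l_2 = -m-1$ nontrivially into that of weight $l_1$, a contradiction.
\<close>

section \<open>Polynomials in characteristic \<open>p\<close>\<close>

text \<open>Generators and relations only produce equations, so the obstacle is to know that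
  something is nonzero. The explicit p by p matrices of the baby Verma modules supply this in one
  statement: no \<open>f ^ m\<close> with m < p lies in the left ideal generated by e and h - l.
  Both the nonvanishing of the idempotents and the final contradiction rest on it. The highest
  weight vectors are elements of the algebra itself, found inside the left ideal of a given nonzero
  element: e is nilpotent, and h satisfies the Artin-Schreier equation X^p - X = s, which splits
  with p distinct roots. Two distinct weights in one block satisfy l_1 + 1 = z and l_2 + 1 = -z.
  Both z and -z solve X^p - X = s, whose left side is odd, so adding gives 2 s = 0 and z lies in the
  prime field. The parameters s and t treat all the algebras together: s decides the shape of the
  central characters, while t only enters through the wrap-around f^p = t in the baby Verma
  modules.\<close>

lemma of_nat_power_CHAR:
  assumes "prime CHAR('a::comm_semiring_1)"
  shows "(of_nat n :: 'a) ^ CHAR('a) = of_nat n"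
proof (induction n)
  case 0
  show ?case using prime_gt_0_nat[OF assms] by (simp add: zero_power)
next
  case (Suc n)
  then show ?case using freshmans_dream[OF assms refl, of "of_nat n" "1"] by (simp add: add.commute)
qed

text \<open>Frobenius is additive and fixes the prime field, so y^p - y does not see integer shifts.
  The passages between weights l, l - 1 and l - 2 j rest on this.\<close>

lemma artin_schreier_shift:
  fixes y :: "'a::comm_ring_1"
  assumes "prime CHAR('a)"
  shows "(y - of_nat n) ^ CHAR('a) - (y - of_nat n) = y ^ CHAR('a) - y"
proof -
  have "y ^ CHAR('a) = ((y - of_nat n) + of_nat n) ^ CHAR('a)" by simp
  also have "\<dots> = (y - of_nat n) ^ CHAR('a) + of_nat n"
    using freshmans_dream[OF assms refl, of "y - of_nat n" "of_nat n"] of_nat_power_CHAR[OF assms] by metis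
  finally show ?thesis by simp
qed

lemma monic_eq_prod_roots:
  fixes q :: "'a::idom poly"
  assumes S: "finite S" and q: "lead_coeff q = 1" "degree q = card S" "\<And>x. x \<in> S \<Longrightarrow> poly q x = 0"
  shows "q = (\<Prod>x\<in>S. [:-x, 1:])"
proof -
  have lc: "lead_coeff (\<Prod>x\<in>S. [:-x, 1:]) = 1" by (simp add: lead_coeff_prod)
  have dg: "degree (\<Prod>x\<in>S. [:-x, 1:]) = card S" using S by (subst degree_prod_eq_sum_degree) auto
  show ?thesis
  proof (rule poly_eqI_degree_lead_coeff[where A = S and n = "card S"])
    show "poly q z = poly (\<Prod>x\<in>S. [:-x, 1:]) z" if "z \<in> S" for z
      using that q(3) S by (auto simp: poly_prod)
  qed (use q lc dg in auto)
qed

text \<open>\<open>Phi\<close> minus a constant, spelled out over a commutative ring: it serves over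
  k and also over k[h], where \<open>Phi\<close>, typed over a field, cannot be written.\<close>

lemma Phi_shape_degree:
  fixes b :: "'a::comm_ring_1"
  assumes "2 < (p::nat)" "odd p"
  defines "Q \<equiv> Polynomial.monom 1 p - Polynomial.monom 2 ((p + 1) div 2) + Polynomial.monom 1 1 - [:b:]"
  shows "degree Q = p" "lead_coeff Q = 1"
proof -
  have m: "(p + 1) div 2 < p" "(p + 1) div 2 \<noteq> 0" using assms(1) by auto
  have "Polynomial.coeff Q i = (if i = p then 1 else 0)" if "i \<ge> p" for i
    using that m assms(1) by (cases i) (auto simp: Q_def coeff_pCons)
  then have c: "Polynomial.coeff Q p = 1" "\<And>i. i > p \<Longrightarrow> Polynomial.coeff Q i = 0" by auto
  show d: "degree Q = p" using c by (intro antisym degree_le le_degree) auto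
  show "lead_coeff Q = 1" using c d by simp
qed

text \<open>At z^2 with z = y - n the left side is (z^p - z)^2 - (y^p - y)^2, which vanishes by
  shift invariance; degrees then match. Two squares (y - m)^2 and (y - n)^2 agree only if m = n or 2
  y = m + n, whence the hypothesis on 2 y. Used twice: with y the variable of k[h] for e^p f^p, and
  with y in k for the roots of \<open>Phi_a\<close>.\<close>

lemma prod_square_shifts:
  fixes y :: "'a::idom" and g :: "nat \<Rightarrow> nat"
  assumes p: "prime p" "2 < p" "CHAR('a) = p"
    and inj: "inj_on (\<lambda>j. (of_nat (g j) :: 'a)) {..<p}"
    and y: "\<And>n. 2 * y \<noteq> of_nat n"
  shows "Polynomial.monom 1 p - Polynomial.monom 2 ((p + 1) div 2) + Polynomial.monom 1 1 - [:(y ^ p - y)\<^sup>2:]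
           = (\<Prod>j<p. [:- (y - of_nat (g j))\<^sup>2, 1:])" (is "?Q = _")
    and "inj_on (\<lambda>j. (y - of_nat (g j))\<^sup>2) {..<p}"
proof -
  have odd: "odd p" using p by (simp add: prime_odd_nat)
  show inj': "inj_on (\<lambda>j. (y - of_nat (g j))\<^sup>2) {..<p}"
  proof (rule inj_onI)
    fix i j assume ij: "i \<in> {..<p}" "j \<in> {..<p}" "(y - of_nat (g i))\<^sup>2 = (y - of_nat (g j))\<^sup>2"
    then have "(of_nat (g i) - of_nat (g j)) * (2 * y - of_nat (g i + g j)) = 0"
      by (simp add: power2_eq_square algebra_simps)
    then have "of_nat (g i) = (of_nat (g j) :: 'a)" using y by (metis mult_eq_0_iff right_minus_eq)
    then show "i = j" using inj ij by (auto dest: inj_onD)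
  qed
  have "?Q = (\<Prod>x\<in>(\<lambda>j. (y - of_nat (g j))\<^sup>2) ` {..<p}. [:-x, 1:])"
  proof (rule monic_eq_prod_roots)
    show "degree ?Q = card ((\<lambda>j. (y - of_nat (g j))\<^sup>2) ` {..<p})"
      using Phi_shape_degree(1)[OF p(2) odd] inj' by (simp add: card_image)
  next
    fix x assume "x \<in> (\<lambda>j. (y - of_nat (g j))\<^sup>2) ` {..<p}"
    then obtain j where x: "x = (y - of_nat (g j))\<^sup>2" by auto
    let ?z = "y - of_nat (g j)"
    have "x ^ ((p + 1) div 2) = ?z * ?z ^ p"
      using odd by (simp add: x flip: power_mult power_Suc)
    then have "poly ?Q x = (?z ^ p - ?z)\<^sup>2 - (y ^ p - y)\<^sup>2"
      by (simp add: x poly_monom flip: power_mult) (simp add: power2_eq_square algebra_simps power_mult)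
    moreover have "?z ^ p - ?z = y ^ p - y" using artin_schreier_shift[of y "g j"] p by metis
    ultimately show "poly ?Q x = 0" by (metis right_minus_eq)
  next
    show "lead_coeff ?Q = 1" by (rule Phi_shape_degree(2)[OF p(2) odd])
  qed simp
  then show "?Q = (\<Prod>j<p. [:- (y - of_nat (g j))\<^sup>2, 1:])"
    using inj' by (simp add: prod.reindex)
qed

lemma of_nat_inj_on_CHAR:
  assumes "CHAR('a::ring_1) = p"
  shows "inj_on (\<lambda>j. (of_nat j :: 'a)) {..<p}"
  using assms by (auto intro!: inj_onI simp: of_nat_eq_iff_cong_CHAR cong_def)

text \<open>Coprimality of linear powers at distinct points, via root multiplicities: the product
  already treated has no root at the new point, so the whole multiplicity there falls on the
  cofactor.\<close>

lemma prod_linear_powers_dvd: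
  fixes q :: "'a::idom poly"
  assumes "finite T" "\<And>x. x \<in> T \<Longrightarrow> [:-x, 1:] ^ n x dvd q"
  shows "(\<Prod>x\<in>T. [:-x, 1:] ^ n x) dvd q"
  using assms
proof (induction T rule: finite_induct)
  case (insert a T)
  let ?P = "\<Prod>x\<in>T. [:-x, 1:] ^ n x"
  obtain r where r: "q = ?P * r" using insert by (metis dvdE insert_iff)
  show ?case
  proof (cases "q = 0")
    case False
    have "poly ?P a \<noteq> 0" using insert by (auto simp: poly_prod)
    then have "Polynomial.order a ?P = 0" by (simp add: order_root)
    then have "Polynomial.order a q = Polynomial.order a r" using False r by (simp add: order_mult)
    moreover have "n a \<le> Polynomial.order a q" using insert.prems[of a] False by (simp add: order_divides)
    ultimately have "[:-a, 1:] ^ n a dvd r" by (simp add: order_divides)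
    then show ?thesis using insert r by (simp add: mult.commute mult_dvd_mono)
  qed simp
qed simp

lemma double_root_dvd:
  fixes r :: "'a::idom poly"
  assumes "poly r a = 0" "poly (pderiv r) a = 0"
  shows "[:-a, 1:] ^ 2 dvd r"
proof -
  obtain s where s: "r = [:-a, 1:] * s" using assms(1) poly_eq_0_iff_dvd by (metis dvdE)
  have "pderiv r = [:-a, 1:] * pderiv s + s"
    unfolding s by (simp only: pderiv_mult) (simp add: pderiv_pCons)
  then have "poly s a = 0" using assms(2) by simp
  then obtain t where "s = [:-a, 1:] * t" using poly_eq_0_iff_dvd by (metis dvdE)
  then have "r = [:-a, 1:] ^ 2 * t" by (simp only: s power2_eq_square mult.assoc)
  then show ?thesis by simp
qed

text \<open>The system of idempotents attached to the factorisation of \<open>\<Psi>\<close>; multiplicities at most 2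
  are all that occurs here, and they ensure that \<open>(c - \<alpha>)\<^sup>2\<close> annihilates the block of \<open>\<alpha>\<close>.\<close>

locale crt_system =
  fixes S :: "'a::field set" and n :: "'a \<Rightarrow> nat" and \<pi> :: "'a \<Rightarrow> 'a poly" and \<Psi> :: "'a poly"
  assumes finite_S: "finite S"
    and Psi: "\<Psi> = (\<Prod>x\<in>S. [:-x, 1:] ^ n x)"
    and n: "\<And>a. a \<in> S \<Longrightarrow> 1 \<le> n a \<and> n a \<le> 2"
    and one: "\<And>a. a \<in> S \<Longrightarrow> [:-a, 1:] ^ n a dvd \<pi> a - 1"
    and zero: "\<And>a b. a \<in> S \<Longrightarrow> b \<in> S \<Longrightarrow> a \<noteq> b \<Longrightarrow> [:-b, 1:] ^ n b dvd \<pi> a"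
begin

lemma Psi_dvdI: "(\<And>a. a \<in> S \<Longrightarrow> [:-a, 1:] ^ n a dvd q) \<Longrightarrow> \<Psi> dvd q"
  unfolding Psi using finite_S by (rule prod_linear_powers_dvd)

lemma idem: assumes "a \<in> S" shows "\<Psi> dvd \<pi> a * \<pi> a - \<pi> a"
proof -
  have "\<pi> a * \<pi> a - \<pi> a = \<pi> a * (\<pi> a - 1)" by (simp add: algebra_simps)
  then show ?thesis using one zero assms by (metis Psi_dvdI dvd_mult dvd_mult2)
qed

lemma orth: "a \<in> S \<Longrightarrow> b \<in> S \<Longrightarrow> a \<noteq> b \<Longrightarrow> \<Psi> dvd \<pi> a * \<pi> b"
  using zero by (metis Psi_dvdI dvd_mult dvd_mult2)

lemma sum_one: "\<Psi> dvd (\<Sum>a\<in>S. \<pi> a) - 1"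
proof (rule Psi_dvdI)
  fix a assume a: "a \<in> S"
  have "(\<Sum>a\<in>S. \<pi> a) - 1 = (\<pi> a - 1) + (\<Sum>b\<in>S - {a}. \<pi> b)"
    using a finite_S by (simp add: sum.remove)
  moreover have "[:-a, 1:] ^ n a dvd (\<Sum>b\<in>S - {a}. \<pi> b)" using a zero by (intro dvd_sum) auto
  ultimately show "[:-a, 1:] ^ n a dvd (\<Sum>a\<in>S. \<pi> a) - 1" using dvd_add[OF one[OF a]] by metis
qed

lemma square_annihilates: assumes "a \<in> S" shows "\<Psi> dvd [:-a, 1:] ^ 2 * \<pi> a"
proof (rule Psi_dvdI)
  fix b assume "b \<in> S"
  then show "[:-b, 1:] ^ n b dvd [:-a, 1:] ^ 2 * \<pi> a"
    using zero[OF assms, of b] n[of a] by (cases "a = b") (auto intro: dvd_mult dvd_mult2 le_imp_power_dvd)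
qed

lemma eval_one: assumes "a \<in> S" shows "poly (\<pi> a) a = 1"
proof -
  have "[:-a, 1:] ^ 1 dvd \<pi> a - 1"
    using one[OF assms] n[OF assms] le_imp_power_dvd dvd_trans by blast
  then show ?thesis using poly_eq_0_iff_dvd[of "\<pi> a - 1" a] by simp
qed

end


lemma linear_dvd_iff: "[:-a, 1:] ^ 1 dvd (q :: 'a::idom poly) \<longleftrightarrow> poly q a = 0"
  by (metis poly_eq_0_iff_dvd power_one_right)

section \<open>Quadratic residues, and the factorisations of \<open>Phi\<close> and
  \<open>Phi_a\<close> over k\<close>

context
  fixes p :: nat
  assumes p: "prime p" "2 < p" "CHAR('k::field) = p"
begin

text \<open>Euler's criterion as a polynomial: its roots are exactly the nonzero quadratic residues,
  all of them simple.\<close>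

definition qr_poly :: "'k poly" where "qr_poly = Polynomial.monom 1 ((p - 1) div 2) - 1"

text \<open>Half of the residues suffices because j and p - j have the same square; this makes the
  enumeration injective.\<close>

definition nonzero_squares :: "'k set" where "nonzero_squares = (\<lambda>j. (of_nat j)\<^sup>2) ` {1..(p - 1) div 2}"

lemma odd_p: "odd p"
  using p by (simp add: prime_odd_nat)

lemma prime_CHAR: "prime CHAR('k)"
  using p by simp

lemma two_nonzero: "(2::'k) \<noteq> 0"
proof
  assume "(2::'k) = 0"
  then have "of_nat 2 = (0::'k)" by simp
  then have "p dvd 2" using p(3) of_nat_eq_0_iff_char_dvd by metis
  then show False using p(2) by (auto dest: dvd_imp_le)
qed

lemma of_nat_nonzero: "0 < j \<Longrightarrow> j < p \<Longrightarrow> of_nat j \<noteq> (0::'k)"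
  using p(3) by (auto simp: of_nat_eq_0_iff_char_dvd dest: dvd_imp_le)

lemma nonzero_squares_bij: "inj_on (\<lambda>j. (of_nat j :: 'k)\<^sup>2) {1..(p - 1) div 2}"
proof (rule inj_onI)
  fix i j assume ij: "i \<in> {1..(p - 1) div 2}" "j \<in> {1..(p - 1) div 2}" "(of_nat i :: 'k)\<^sup>2 = (of_nat j)\<^sup>2"
  then have "(of_nat i - of_nat j) * (of_nat (i + j) :: 'k) = 0"
    by (simp add: power2_eq_square algebra_simps)
  moreover have "of_nat (i + j) \<noteq> (0::'k)" using ij by (intro of_nat_nonzero) auto
  ultimately have "of_nat i = (of_nat j :: 'k)" by simp
  then show "i = j" using of_nat_inj_on_CHAR[OF p(3)] ij by (auto dest: inj_onD)
qed

lemma qr_poly_prod: "qr_poly = (\<Prod>x\<in>nonzero_squares. [:-x, 1:])"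
proof (rule monic_eq_prod_roots)
  let ?m = "(p - 1) div 2"
  have m: "?m > 0" using p(2) by auto
  have "Polynomial.coeff qr_poly i = (if i = ?m then 1 else 0)" if "i \<ge> ?m" for i
    using that m by (auto simp: qr_poly_def)
  then have c: "Polynomial.coeff qr_poly ?m = 1" "\<And>i. i > ?m \<Longrightarrow> Polynomial.coeff qr_poly i = 0" by auto
  have d: "degree qr_poly = ?m" using c by (intro antisym degree_le le_degree) auto
  show "lead_coeff qr_poly = 1" using c d by simp
  show "degree qr_poly = card nonzero_squares" using nonzero_squares_bij d by (simp add: nonzero_squares_def card_image)
  show "finite nonzero_squares" by (simp add: nonzero_squares_def)
  fix x assume "x \<in> nonzero_squares"
  then obtain j where j: "j \<in> {1..?m}" "x = (of_nat j)\<^sup>2" by (auto simp: nonzero_squares_def)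
  have "of_nat j * (of_nat j :: 'k) ^ (p - 1) = of_nat j * 1"
    using of_nat_power_CHAR[OF prime_CHAR, of j] p by (simp flip: power_Suc)
  moreover have "of_nat j \<noteq> (0::'k)" using j by (intro of_nat_nonzero) auto
  ultimately have "(of_nat j :: 'k) ^ (p - 1) = 1" using mult_left_cancel by blast
  moreover have "2 * ?m = p - 1" using odd_p by auto
  ultimately show "poly qr_poly x = 0" by (simp add: qr_poly_def poly_monom j flip: power_mult)
qed

text \<open>The source of the multiplicities in the nilpotent case: a simple root at 0 and a double
  root at every nonzero residue.\<close>

lemma Phi_factor: "Phi p = [:0, 1:] * (qr_poly :: 'k poly)\<^sup>2"
proof -
  let ?m = "(p - 1) div 2"
  obtain k where "p = 2 * k + 1" using odd_p by (auto elim: oddE)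
  then have m: "2 * ?m + 1 = p" "(p + 1) div 2 = ?m + 1" by auto
  have sq: "x * (y - 1)\<^sup>2 = x * (y * y) - (x * y + x * y) + x" for x y :: "'k poly"
    by (simp add: power2_eq_square algebra_simps)
  have "Phi p = (Polynomial.monom 1 (1 + (?m + ?m)) :: 'k poly)
      - (Polynomial.monom 1 (1 + ?m) + Polynomial.monom 1 (1 + ?m)) + Polynomial.monom 1 1"
    unfolding Phi_def m(2) using m(1) by (simp add: add_monom mult_2)
  also have "\<dots> = Polynomial.monom 1 1 * qr_poly\<^sup>2"
    unfolding qr_poly_def sq mult_monom by simp
  also have "Polynomial.monom 1 1 = ([:0, 1:] :: 'k poly)" by (simp add: monom_Suc)
  finally show ?thesis .
qed

lemma qr_index_eq: "qr_index p = insert 0 nonzero_squares"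
proof (rule Set.set_eqI, rule iffI)
  fix x :: 'k assume "x \<in> qr_index p"
  then obtain m where m: "x = of_int m" "Legendre m (int p) \<noteq> -1" by (auto simp: qr_index_def)
  show "x \<in> insert 0 nonzero_squares"
  proof (cases "x = 0")
    case False
    then have "\<not> [m = 0] (mod int p)" using m(1) p(3) of_int_eq_iff_cong_CHAR by (metis of_int_0)
    then have "QuadRes (int p) m" using m(2) by (auto simp: Legendre_def split: if_splits)
    then obtain y where "[y\<^sup>2 = m] (mod int p)" by (auto simp: QuadRes_def)
    then have "x = of_int (y\<^sup>2)" using m(1) p(3) of_int_eq_iff_cong_CHAR by metis
    moreover define j where "j = nat \<bar>y\<bar>"
    then have "y\<^sup>2 = int j ^ 2" by simp
    ultimately have x: "x = (of_nat j)\<^sup>2" by simp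
    then have j: "(of_nat j :: 'k) \<noteq> 0" using False by auto
    have "of_nat j * (of_nat j :: 'k) ^ (p - 1) = of_nat j * 1"
      using of_nat_power_CHAR[OF prime_CHAR, of j] p by (simp flip: power_Suc)
    then have "(of_nat j :: 'k) ^ (p - 1) = 1" using j mult_left_cancel by blast
    moreover have "2 * ((p - 1) div 2) = p - 1" using odd_p by auto
    \<comment> \<open>Instead of reducing j to the range up to (p - 1)/2, x is shown to be a root of
      \<open>qr_poly\<close>, whose roots are already listed.\<close>
    ultimately have "poly qr_poly x = 0" by (simp add: qr_poly_def poly_monom x flip: power_mult)
    then show ?thesis by (auto simp: qr_poly_prod poly_prod nonzero_squares_def)
  qed simp
next
  fix x :: 'k assume "x \<in> insert 0 nonzero_squares"
  then have "\<exists>j. x = (of_nat j)\<^sup>2" unfolding nonzero_squares_def by (auto intro: exI[of _ "0::nat"])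
  then obtain j where j: "x = (of_nat j)\<^sup>2" ..
  have c: "[int j ^ 2 = int j ^ 2 mod int p] (mod int p)" by (simp add: cong_def)
  have "x = of_int (int j ^ 2)" by (simp add: j)
  also have "\<dots> = of_int (int j ^ 2 mod int p)"
    using c p(3) of_int_eq_iff_cong_CHAR by metis
  finally have "x = of_int (int j ^ 2 mod int p)" .
  moreover have "QuadRes (int p) (int j ^ 2 mod int p)"
    unfolding QuadRes_def by (rule exI, rule c)
  then have "Legendre (int j ^ 2 mod int p) (int p) \<noteq> -1" by (simp add: Legendre_def)
  moreover have "0 \<le> int j ^ 2 mod int p" "int j ^ 2 mod int p < int p" using p by auto
  ultimately show "x \<in> qr_index p" unfolding qr_index_def by blast
qed

lemma zero_notin_nonzero_squares: "0 \<notin> nonzero_squares"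
  using of_nat_nonzero by (auto simp: nonzero_squares_def)

text \<open>Write Q for \<open>qr_poly\<close>. Since 2 (p - 1)/2 = -1 in k, it satisfies 2 c Q' =
  -(Q + 1). Evaluating this equation and its derivative at the root a, where Q'(a) = q(a) and Q''(a)
  = 2 q'(a), gives the two numerical identities; they are the first-order data of q at a.\<close>

lemma qr_poly_split:
  assumes "a \<in> nonzero_squares"
  obtains q where "qr_poly = [:-a, 1:] * q" "2 * a * poly q a = -1" "4 * a * poly (pderiv q) a = -3 * poly q a"
    "[:-a, 1:] ^ 2 * Polynomial.smult 2 ([:a, 1:] * [:0, 1:] * q\<^sup>2) = Polynomial.smult 2 ([:a, 1:] * Phi p)"
proof -
  have fin: "finite nonzero_squares" by (simp add: nonzero_squares_def)
  then have "poly qr_poly a = 0" using assms by (auto simp: qr_poly_prod poly_prod)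
  then obtain q where q: "qr_poly = [:-a, 1:] * q" using poly_eq_0_iff_dvd by (metis dvdE)
  let ?m = "(p - 1) div 2"
  have "2 * ?m + 1 = p" using odd_p by auto
  then have "of_nat (2 * ?m + 1) = (0::'k)" using p(3) of_nat_CHAR by metis
  then have m: "2 * of_nat ?m = (-1::'k)" by (simp add: eq_neg_iff_add_eq_0 add.commute)
  obtain l where l: "?m = Suc l" using p(2) by (cases ?m) auto
  have qr_poly: "qr_poly = Polynomial.monom 1 (Suc l) - 1" unfolding qr_poly_def l ..
  have "[:0, 1:] * pderiv qr_poly = Polynomial.smult (of_nat ?m) (qr_poly + 1)"
    unfolding qr_poly l by (simp add: pderiv_diff pderiv_monom) (simp add: monom_Suc smult_monom)
  then have "Polynomial.smult 2 ([:0, 1:] * pderiv qr_poly) = - (qr_poly + 1)" using m by (metis smult_smult smult_minus_left smult_1_left)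
  then have D: "[:0, 2:] * pderiv qr_poly = - qr_poly - 1" by simp
  have h1: "pderiv qr_poly = q + [:-a, 1:] * pderiv q"
    unfolding q by (simp only: pderiv_mult) (simp add: pderiv_pCons)
  have ev: "poly qr_poly a = 0" "poly (pderiv qr_poly) a = poly q a" using h1 q by simp_all
  have e1: "2 * a * poly q a = -1"
    using arg_cong[OF D, of "\<lambda>r. poly r a"] unfolding poly_mult poly_diff poly_minus ev by (simp add: mult_ac)
  have "pderiv ([:0, 2:] * pderiv qr_poly) = - pderiv qr_poly" unfolding D by (simp add: pderiv_minus pderiv_diff)
  then have D2: "[:0, 2:] * pderiv (pderiv qr_poly) + pderiv qr_poly * [:2:] = - pderiv qr_poly"
    by (simp only: pderiv_mult) (simp add: pderiv_pCons)
  have "pderiv (pderiv qr_poly) = pderiv q + ([:-a, 1:] * pderiv (pderiv q) + pderiv q)"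
    unfolding h1 by (simp only: pderiv_mult pderiv_add) (simp add: pderiv_pCons)
  then have ev2: "poly (pderiv (pderiv qr_poly)) a = 2 * poly (pderiv q) a" by simp
  have "4 * a * poly (pderiv q) a + 3 * poly q a = 0"
    using arg_cong[OF D2, of "\<lambda>r. poly r a"] unfolding poly_mult poly_add poly_minus ev ev2
    by (simp add: algebra_simps eq_neg_iff_add_eq_0)
  then have e2: "4 * a * poly (pderiv q) a = -3 * poly q a" by (simp add: eq_neg_iff_add_eq_0)
  show thesis
  proof (rule that[OF q e1 e2])
    show "[:-a, 1:] ^ 2 * Polynomial.smult 2 ([:a, 1:] * [:0, 1:] * q\<^sup>2) = Polynomial.smult 2 ([:a, 1:] * Phi p)"
      unfolding Phi_factor q by (simp only: power_mult_distrib mult_smult_right) (simp only: mult_ac)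
  qed
qed

lemma pi_res_simps:
  shows "pi_res p 0 = (qr_poly\<^sup>2 :: 'k poly)"
    and "a \<in> nonzero_squares \<Longrightarrow> qr_poly = [:-a, 1:] * q \<Longrightarrow> pi_res p a = Polynomial.smult 2 ([:a, 1:] * [:0, 1:] * q\<^sup>2)"
proof -
  show "pi_res p 0 = (qr_poly\<^sup>2 :: 'k poly)"
    unfolding pi_res_def Phi_factor by (simp add: nonzero_mult_div_cancel_left del: mult_pCons_left)
  assume a: "a \<in> nonzero_squares" "qr_poly = [:-a, 1:] * q"
  have "Polynomial.smult 2 ([:a, 1:] * Phi p) = [:-a, 1:] ^ 2 * Polynomial.smult 2 ([:a, 1:] * [:0, 1:] * q\<^sup>2)"
    unfolding Phi_factor a by (simp only: power_mult_distrib mult_smult_right) (simp only: mult_ac)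
  moreover have "a \<noteq> 0" using a zero_notin_nonzero_squares by auto
  ultimately show "pi_res p a = Polynomial.smult 2 ([:a, 1:] * [:0, 1:] * q\<^sup>2)"
    unfolding pi_res_def by (metis nonzero_mult_div_cancel_left power_not_zero pCons_eq_0_iff one_neq_zero)
qed

text \<open>The factor 2 (c + a) answers the double root at a. The polynomial 2 c (c + a) q^2 has
  value (2 a q(a))^2 = 1 at a and derivative 2 a q(a) (3 q(a) + 4 a q'(a)) = 0 there, so it is 1
  modulo (c - a)^2 and not merely modulo c - a.\<close>

lemma crt_nilpotent:
  "crt_system (qr_index p :: 'k set) (\<lambda>a. if a = 0 then 1 else 2) (pi_res p) (Phi p)"
proof
  let ?n = "\<lambda>a::'k. if a = 0 then 1 else 2 :: nat"
  have fin: "finite nonzero_squares" by (simp add: nonzero_squares_def)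
  then show "finite (qr_index p :: 'k set)" by (simp add: qr_index_eq)
  have "(\<Prod>x\<in>nonzero_squares. [:-x, 1:] ^ ?n x) = (\<Prod>x\<in>nonzero_squares. [:-x, 1:] ^ 2)"
    using zero_notin_nonzero_squares by (intro prod.cong) auto
  then show "Phi p = (\<Prod>x\<in>qr_index p. [:-x::'k, 1:] ^ ?n x)"
    unfolding qr_index_eq Phi_factor qr_poly_prod using fin zero_notin_nonzero_squares by (simp add: prod_power_distrib del: mult_pCons_left)
  show "1 \<le> ?n a \<and> ?n a \<le> 2" for a by simp
  show "[:-a, 1:] ^ ?n a dvd pi_res p a - 1" if "a \<in> qr_index p" for a :: 'k
  proof (cases "a = 0")
    case True
    \<comment> \<open>A positive exponent makes the monomial vanish at 0, so that the value there is
      (-1)^2 = 1.\<close>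
    have "(p - 1) div 2 \<noteq> 0" using p(2) by auto
    then have "poly (pi_res p a - 1) a = 0" by (simp add: True pi_res_simps qr_poly_def poly_monom zero_power)
    then show ?thesis unfolding True using linear_dvd_iff by (metis)
  next
    case False
    then have a: "a \<in> nonzero_squares" using that qr_index_eq by auto
    obtain q where q: "qr_poly = [:-a, 1:] * q" "2 * a * poly q a = -1" "4 * a * poly (pderiv q) a = -3 * poly q a"
      using qr_poly_split[OF a] by metis
    have pi: "pi_res p a = [:0, 2 * a, 2:] * (q * q)"
      unfolding pi_res_simps(2)[OF a q(1)] by (simp add: power2_eq_square smult_add_right smult_add_left ac_simps)
    have "[:-a, 1:] ^ 2 dvd pi_res p a - 1"
    proof (rule double_root_dvd)
      have "poly (pi_res p a) a = (2 * a * poly q a) * (2 * a * poly q a)"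
        by (simp add: pi algebra_simps)
      then show "poly (pi_res p a - 1) a = 0" by (simp add: q)
      have "pderiv (pi_res p a) = [:2 * a, 4:] * (q * q) + [:0, 2 * a, 2:] * (2 * q * pderiv q)"
        unfolding pi by (simp only: pderiv_mult) (simp add: pderiv_pCons algebra_simps)
      then have "poly (pderiv (pi_res p a)) a = (2 * a * poly q a) * (3 * poly q a + 4 * a * poly (pderiv q) a)"
        by (simp add: algebra_simps)
      then show "poly (pderiv (pi_res p a - 1)) a = 0" by (simp add: q pderiv_diff)
    qed
    then show ?thesis using False by simp
  qed
  show "[:-b, 1:] ^ ?n b dvd pi_res p a" if ab: "a \<in> qr_index p" "b \<in> qr_index p" "a \<noteq> b" for a b :: 'k
  proof (cases "a = 0")
    case True
    then have "b \<in> nonzero_squares" using ab qr_index_eq by auto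
    then have "[:-b, 1:] dvd qr_poly" using fin using poly_eq_0_iff_dvd[of qr_poly b] by (auto simp: qr_poly_prod poly_prod)
    then show ?thesis using True ab by (simp add: pi_res_simps dvd_power_same)
  next
    case False
    then have a: "a \<in> nonzero_squares" using ab qr_index_eq by auto
    obtain q where q: "qr_poly = [:-a, 1:] * q" using qr_poly_split[OF a] by metis
    have pi: "pi_res p a = Polynomial.smult 2 ([:a, 1:] * [:0, 1:] * q\<^sup>2)"
      by (rule pi_res_simps(2)[OF a q])
    show ?thesis
    proof (cases "b = 0")
      case True
      moreover have "[:-0, 1:] ^ 1 dvd pi_res p a" unfolding pi linear_dvd_iff by simp
      ultimately show ?thesis by presburger
    next
      case False
      then have "b \<in> nonzero_squares" using ab qr_index_eq by auto
      then have "poly qr_poly b = 0" using fin by (simp add: qr_poly_prod poly_prod)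
      then have "poly q b = 0" using q ab by simp
      then have "[:-b, 1:] ^ 2 dvd q\<^sup>2" using poly_eq_0_iff_dvd dvd_power_same by blast
      then have "[:-b, 1:] ^ 2 dvd pi_res p a" unfolding pi by (intro dvd_smult dvd_mult)
      then show ?thesis using False by presburger
    qed
  qed
qed

text \<open>For a = j^2 the weight is j - 1. Each index is thus the central character of some baby
  Verma module, which later keeps its idempotent from vanishing.\<close>

lemma qr_index_weight:
  assumes "(a::'k) \<in> qr_index p"
  shows "\<exists>l. (l + 1)\<^sup>2 = a \<and> l ^ p - l = 0"
proof -
  have "\<exists>j. a = (of_nat j)\<^sup>2"
    using assms unfolding qr_index_eq nonzero_squares_def by (auto intro: exI[of _ "0::nat"])
  then obtain j where "a = (of_nat j)\<^sup>2" ..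
  moreover have "((of_nat j :: 'k) - of_nat 1) ^ p - (of_nat j - of_nat 1) = of_nat j ^ p - of_nat j"
    using artin_schreier_shift[OF prime_CHAR, of "of_nat j" 1] p(3) by simp
  moreover have "(of_nat j :: 'k) ^ p - of_nat j = 0"
    using of_nat_power_CHAR[OF prime_CHAR, of j] p(3) by simp
  ultimately show ?thesis by (intro exI[of _ "of_nat j - 1"]) simp
qed

lemma artin_schreier_root:
  assumes "alg_closed TYPE('k)"
  shows "\<exists>y::'k. y ^ p - y = s"
proof -
  let ?q = "Polynomial.monom 1 p - [:s, 1:] :: 'k poly"
  have "Polynomial.coeff ?q p = 1" using p(2) by (cases p) (auto simp: coeff_pCons split: nat.splits)
  then have "degree ?q > 0" using p(2) le_degree[of ?q p] by auto
  then obtain y where "poly ?q y = 0" using assms unfolding alg_closed_def by blast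
  then show ?thesis by (intro exI[of _ y]) (simp add: poly_monom algebra_simps)
qed

text \<open>If 2 y were in the prime field, so would be y, and y^p - y would be 0. This is what
  separates the p squares (y - j)^2 when a is nonzero.\<close>

lemma double_not_in_prime_field:
  assumes "(y::'k) ^ p - y \<noteq> 0"
  shows "2 * y \<noteq> of_nat n"
proof
  assume y: "2 * y = of_nat n"
  have "(2 * y) ^ p = 2 * y" using of_nat_power_CHAR[OF prime_CHAR, of n] p(3) y by simp
  moreover have "(2::'k) ^ p = 2" using of_nat_power_CHAR[OF prime_CHAR, of 2] p(3) by simp
  ultimately have "2 * (y ^ p - y) = 0" by (simp add: power_mult_distrib algebra_simps)
  then show False using assms two_nonzero by simp
qed

lemma Phi_a_roots:
  assumes "a \<noteq> 0" "alg_closed TYPE('k)"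
  obtains y :: 'k where "y ^ p - y = a"
    "Phi_a p a = (\<Prod>x\<in>{x. poly (Phi_a p a) x = 0}. [:-x, 1:])"
    "{x. poly (Phi_a p a) x = 0} = (\<lambda>j. (y - of_nat j)\<^sup>2) ` {..<p}"
proof -
  obtain y :: 'k where y: "y ^ p - y = a" using artin_schreier_root[OF assms(2)] by blast
  have y2: "2 * y \<noteq> of_nat n" for n using double_not_in_prime_field y assms by auto
  note sq = prod_square_shifts[OF p of_nat_inj_on_CHAR[OF p(3)] y2]
  let ?R = "(\<lambda>j. (y - of_nat j)\<^sup>2) ` {..<p}"
  have P: "Phi_a p a = (\<Prod>x\<in>?R. [:-x, 1:])"
    using sq unfolding Phi_a_def Phi_def y by (simp add: prod.reindex)
  have R: "{x. poly (Phi_a p a) x = 0} = ?R" unfolding P by (auto simp: poly_prod)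
  show thesis by (rule that[OF y _ R]) (use P R in metis)
qed

text \<open>All p roots are simple here, so the Chinese remainder idempotents are the Lagrange
  interpolation polynomials.\<close>

lemma crt_semisimple:
  assumes "(a::'k) \<noteq> 0" "alg_closed TYPE('k)"
  shows "crt_system {x. poly (Phi_a p a) x = 0} (\<lambda>_. 1) (pi_a p a) (Phi_a p a)"
proof -
  let ?R = "{x. poly (Phi_a p a) x = 0}"
  obtain y :: 'k where P: "Phi_a p a = (\<Prod>x\<in>?R. [:-x, 1:])"
    and R: "?R = (\<lambda>j. (y - of_nat j)\<^sup>2) ` {..<p}"
    by (rule Phi_a_roots[OF assms])
  have fin: "finite ?R" unfolding R by simp
  have pi: "pi_a p a x = Polynomial.smult (inverse (poly q x)) q \<and> poly q x \<noteq> 0 \<and> (\<forall>z\<in>?R. z \<noteq> x \<longrightarrow> poly q z = 0)"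
    if "x \<in> ?R" and q: "q = (\<Prod>z\<in>?R - {x}. [:-z, 1:])" for x q
  proof -
    have "Phi_a p a = [:-x, 1:] * q" unfolding q using P prod.remove[OF fin that(1), of "\<lambda>x. [:-x, 1:]"] by metis
    then have "Phi_a p a div [:-x, 1:] = q" by (metis nonzero_mult_div_cancel_left one_neq_zero pCons_eq_0_iff)
    then show ?thesis using fin by (auto simp: pi_a_def q poly_prod)
  qed
  show ?thesis
  proof
    show "finite ?R" by (rule fin)
    show "Phi_a p a = (\<Prod>x\<in>?R. [:-x, 1:] ^ 1)" using P by simp
    show "[:-x, 1:] ^ 1 dvd pi_a p a x - 1" if "x \<in> ?R" for x
      using pi[OF that refl] unfolding linear_dvd_iff by simp
    show "[:-z, 1:] ^ 1 dvd pi_a p a x" if "x \<in> ?R" "z \<in> ?R" "x \<noteq> z" for x z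
      using pi[OF that(1) refl] that unfolding linear_dvd_iff by simp
  qed simp
qed

lemma Phi_a_weight:
  assumes "a \<noteq> 0" "alg_closed TYPE('k)" "poly (Phi_a p a) x = 0"
  shows "\<exists>l. (l + 1)\<^sup>2 = x \<and> l ^ p - l = (a::'k)"
proof -
  obtain y :: 'k where y: "y ^ p - y = a"
    and R: "{x. poly (Phi_a p a) x = 0} = (\<lambda>j. (y - of_nat j)\<^sup>2) ` {..<p}"
    by (rule Phi_a_roots[OF assms(1,2)])
  then obtain j where x: "x = (y - of_nat j)\<^sup>2" using assms(3) by auto
  \<comment> \<open>One more shift than in the root (y - j)^2, because the weight enters as l +
    1.\<close>
  have "(y - of_nat (Suc j)) ^ p - (y - of_nat (Suc j)) = a"
    using artin_schreier_shift[OF prime_CHAR, of y "Suc j"] p(3) y by metis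
  then show ?thesis by (intro exI[of _ "y - of_nat (Suc j)"]) (simp add: x)
qed

end

section \<open>Highest weight theory\<close>

text \<open>Evaluation at an element of a noncommutative ring, with coefficients carried over by
  \<phi>. It is used nested: with \<phi> the scalars and x equal to h or c, and with \<phi> the
  evaluation at h and x = c, which evaluates elements of k[h][c].\<close>

definition pev :: "('b::comm_ring_1 \<Rightarrow> 'a::ring_1) \<Rightarrow> 'a \<Rightarrow> 'b poly \<Rightarrow> 'a" where
  "pev \<phi> x q = (\<Sum>i\<le>degree q. \<phi> (Polynomial.coeff q i) * x ^ i)"

locale poly_eval =
  fixes \<phi> :: "'b::comm_ring_1 \<Rightarrow> 'a::ring_1" and x :: 'a
  assumes hom_add: "\<phi> (a + b) = \<phi> a + \<phi> b"
    and hom_mult: "\<phi> (a * b) = \<phi> a * \<phi> b"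
    and hom_one: "\<phi> 1 = 1"
    and hom_comm: "\<phi> a * x = x * \<phi> a"
begin

lemma hom_zero: "\<phi> 0 = 0"
  using hom_add[of 0 0] by simp

lemma hom_minus: "\<phi> (- a) = - \<phi> a"
  using hom_add[of a "- a"] hom_zero by (simp add: eq_neg_iff_add_eq_0 add.commute)

lemma hom_of_nat: "\<phi> (of_nat n) = of_nat n"
  by (induction n) (simp_all add: hom_zero hom_add hom_one)

lemma pev_upto: "degree q \<le> n \<Longrightarrow> pev \<phi> x q = (\<Sum>i\<le>n. \<phi> (Polynomial.coeff q i) * x ^ i)"
  unfolding pev_def by (rule sum.mono_neutral_left) (auto simp: coeff_eq_0 hom_zero)

lemma pev_0 [simp]: "pev \<phi> x 0 = 0"
  by (simp add: pev_def hom_zero)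

lemma pev_pCons: "pev \<phi> x (pCons a q) = \<phi> a + x * pev \<phi> x q"
proof -
  have c: "\<phi> b * x ^ Suc i = x * (\<phi> b * x ^ i)" for b i
    by (metis hom_comm mult.assoc power_Suc)
  have "pev \<phi> x (pCons a q) = (\<Sum>i\<le>Suc (degree q). \<phi> (Polynomial.coeff (pCons a q) i) * x ^ i)"
    by (rule pev_upto) (simp add: degree_pCons_le)
  also have "\<dots> = \<phi> a + (\<Sum>i\<le>degree q. \<phi> (Polynomial.coeff q i) * x ^ Suc i)"
    by (subst sum.atMost_Suc_shift) simp
  also have "\<dots> = \<phi> a + x * pev \<phi> x q"
    by (simp only: c pev_def sum_distrib_left)
  finally show ?thesis .
qed

lemma pev_const: "pev \<phi> x [:a:] = \<phi> a"
  by (simp add: pev_pCons)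

lemma pev_1 [simp]: "pev \<phi> x 1 = 1"
  using pev_const[of 1] hom_one by (simp add: one_pCons)

lemma pev_add: "pev \<phi> x (q + r) = pev \<phi> x q + pev \<phi> x r"
proof -
  let ?n = "max (degree q) (degree r)"
  have "pev \<phi> x (q + r) = (\<Sum>i\<le>?n. \<phi> (Polynomial.coeff (q + r) i) * x ^ i)"
    by (rule pev_upto) (rule degree_add_le_max)
  also have "\<dots> = pev \<phi> x q + pev \<phi> x r"
    by (simp add: pev_upto[of q ?n] pev_upto[of r ?n] hom_add algebra_simps sum.distrib)
  finally show ?thesis .
qed

lemma pev_smult: "pev \<phi> x (Polynomial.smult a q) = \<phi> a * pev \<phi> x q"
  by (subst pev_upto[of _ "degree q"]) (simp_all add: degree_smult_le pev_def hom_mult sum_distrib_left mult.assoc)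

lemma pev_mult: "pev \<phi> x (q * r) = pev \<phi> x q * pev \<phi> x r"
  by (induction q) (simp_all add: pev_pCons pev_add pev_smult hom_zero algebra_simps)

lemma pev_minus: "pev \<phi> x (- q) = - pev \<phi> x q"
  using pev_smult[of "-1" q] by (simp add: hom_minus hom_one)

lemma pev_diff: "pev \<phi> x (q - r) = pev \<phi> x q - pev \<phi> x r"
  using pev_add[of q "- r"] by (simp add: pev_minus)

lemma pev_sum: "pev \<phi> x (\<Sum>i\<in>A. q i) = (\<Sum>i\<in>A. pev \<phi> x (q i))"
  by (induction A rule: infinite_finite_induct) (simp_all add: pev_add)

lemma pev_power: "pev \<phi> x (q ^ n) = pev \<phi> x q ^ n"
  by (induction n) (simp_all add: pev_mult)

lemma pev_X: "pev \<phi> x [:0, 1:] = x"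
  by (simp add: pev_pCons hom_zero hom_one)

lemma pev_monom: "pev \<phi> x (Polynomial.monom a n) = \<phi> a * x ^ n"
proof -
  have "Polynomial.monom a n = Polynomial.smult a ([:0, 1:] ^ n)" by (rule monom_altdef)
  then show ?thesis by (simp only: pev_smult pev_power pev_X)
qed

lemma pev_of_nat: "pev \<phi> x (of_nat n) = of_nat n"
  by (induction n) (simp_all add: pev_add)

lemma pev_commute:
  assumes "y * x = x * y" "\<And>a. y * \<phi> a = \<phi> a * y"
  shows "y * pev \<phi> x q = pev \<phi> x q * y"
  by (induction q) (simp_all add: pev_pCons algebra_simps assms, metis assms mult.assoc)

end

text \<open>The central idempotent \<open>d\<close> encodes reduction: an equation multiplied by \<open>d\<close> is an equation in
  the reduced enveloping algebra with parameters \<open>s\<close> and \<open>t\<close>.\<close>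

locale sl2_alg =
  fixes e f h d :: "'a::ring_1" and sc :: "'k::field \<Rightarrow> 'a" and p :: nat and s t :: 'k
  assumes p: "prime p" "2 < p" "CHAR('k) = p"
    and sc_add: "sc (a + b) = sc a + sc b"
    and sc_mult: "sc (a * b) = sc a * sc b"
    and sc_one: "sc 1 = 1"
    and sc_comm: "sc a * x = x * sc a"
    and d_comm: "d * x = x * d"
    and d_idem: "d * d = d"
    and ef: "e * f - f * e = h"
    and he: "h * e - e * h = 2 * e"
    and hf: "h * f - f * h = - (2 * f)"
    and e_p: "d * e ^ p = 0"
    and f_p: "d * f ^ p = d * sc t"
    and h_p: "d * (h ^ p - h) = d * sc s"
    and root: "\<exists>y. y ^ p - y = s"
begin

section \<open>Commutation relations and the equation satisfied by the central element\<close>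

definition c :: 'a where "c = (h - 1)\<^sup>2 + 4 * (e * f)"

text \<open>The subalgebra generated by e, f, h and the scalars. The ambient ring may be larger, and
  c is shown to commute with this part of it.\<close>

inductive_set G :: "'a set" where
  G_one: "1 \<in> G"
| G_e: "x \<in> G \<Longrightarrow> e * x \<in> G"
| G_f: "x \<in> G \<Longrightarrow> f * x \<in> G"
| G_h: "x \<in> G \<Longrightarrow> h * x \<in> G"
| G_sc: "x \<in> G \<Longrightarrow> sc a * x \<in> G"
| G_add: "x \<in> G \<Longrightarrow> y \<in> G \<Longrightarrow> x + y \<in> G"

lemma nf:
  "h * f = f * h - (f + f)" "e * h = h * e - (e + e)" "e * f = f * e + h"
  using ef he hf by (simp_all add: algebra_simps mult_2)

lemma nf_assoc:
  "h * (f * x) = f * (h * x) - (f * x + f * x)" "e * (h * x) = h * (e * x) - (e * x + e * x)"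
  "e * (f * x) = f * (e * x) + h * x"
  by (simp_all add: nf algebra_simps flip: mult.assoc)

text \<open>This is c = (h + 1)^2 + 4 f e, the form from which the value (l + 1)^2 on a highest
  weight vector can be read off.\<close>

lemma c_nf: "c = h * h + h + h + 1 + (f * e + f * e + f * e + f * e)"
proof -
  have four: "(4::'a) = 1 + 1 + 1 + 1" by simp
  have "c = (h - 1) * (h - 1) + (e * f + e * f + e * f + e * f)"
    unfolding c_def power2_eq_square four by (simp only: distrib_right mult_1_left)
  then show ?thesis by (simp add: nf algebra_simps)
qed

lemma c_e: "c * e = e * c" and c_f: "c * f = f * c" and c_h: "c * h = h * c"
  by (simp_all add: c_nf algebra_simps nf nf_assoc)

sublocale PH: poly_eval sc h
  by unfold_locales (rule sc_add sc_mult sc_one sc_comm)+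

sublocale PC: poly_eval sc c
  by unfold_locales (rule sc_add sc_mult sc_one sc_comm)+

sublocale PB: poly_eval "pev sc h" c
proof unfold_locales
  show "pev sc h a * c = c * pev sc h a" for a
    by (rule PH.pev_commute[symmetric]) (simp_all add: c_h sc_comm[of _ c])
qed (simp_all add: PH.pev_add PH.pev_mult)

lemma sc_of_nat: "sc (of_nat n) = of_nat n"
  by (rule PH.hom_of_nat)

lemma sc_minus: "sc (- a) = - sc a"
  by (rule PH.hom_minus)

lemma sc_diff: "sc (a - b) = sc a - sc b"
  using sc_add[of a "- b"] by (simp add: sc_minus)

lemma sc_zero [simp]: "sc 0 = 0"
  by (rule PH.hom_zero)

lemma sc_numeral: "sc (numeral n) = numeral n"
  using sc_of_nat[of "numeral n"] by simp

lemma sc_left_commute: "x * (sc a * y) = sc a * (x * y)"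
  using sc_comm[of a x] by (simp flip: mult.assoc)

lemma d_left_commute: "x * (d * y) = d * (x * y)"
  using d_comm[of x] by (simp flip: mult.assoc)

lemma d_d: "d * (d * x) = d * x"
  using d_idem by (simp flip: mult.assoc)

lemma sc_cancel:
  assumes "sc a * v = 0" "a \<noteq> 0" shows "v = 0"
proof -
  have "v = sc (inverse a * a) * v" using assms(2) by (simp add: sc_one)
  also have "\<dots> = sc (inverse a) * (sc a * v)" by (simp only: sc_mult mult.assoc)
  finally show ?thesis using assms(1) by simp
qed

lemma h_f_pow: "h * f ^ i = f ^ i * (h - of_nat (2 * i))"
proof (induction i)
  case (Suc i)
  have "h * f ^ Suc i = (f * h - (f + f)) * f ^ i" by (simp add: nf flip: mult.assoc)
  also have "\<dots> = f * (h * f ^ i) - (f * f ^ i + f * f ^ i)" by (simp add: algebra_simps)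
  also have "\<dots> = f ^ Suc i * (h - of_nat (2 * Suc i))" by (simp add: Suc algebra_simps)
  finally show ?case .
qed simp

lemma e_f_pow: "e * f ^ Suc i = f ^ Suc i * e + f ^ i * (of_nat (Suc i) * (h - of_nat i))"
proof (induction i)
  case 0
  then show ?case by (simp add: nf)
next
  case (Suc i)
  have "e * f ^ Suc (Suc i) = (e * f) * f ^ Suc i" by (simp only: power_Suc mult.assoc)
  also have "\<dots> = f * (e * f ^ Suc i) + h * f ^ Suc i" by (simp only: nf(3) distrib_right mult.assoc)
  also have "\<dots> = f ^ Suc (Suc i) * e + f ^ Suc i * (of_nat (Suc i) * (h - of_nat i) + (h - of_nat (2 * Suc i)))"
    unfolding Suc h_f_pow by (simp add: algebra_simps mult_2_right)
  also have "of_nat (Suc i) * (h - of_nat i) + (h - of_nat (2 * Suc i)) = of_nat (Suc (Suc i)) * (h - of_nat (Suc i))"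
    by (simp add: algebra_simps mult_2_right)
  finally show ?case .
qed

lemma c_f_pow: "c * f ^ i = f ^ i * c"
proof (induction i)
  case (Suc i)
  have "c * f ^ Suc i = f * (c * f ^ i)" using c_f by (simp flip: mult.assoc)
  then show ?case by (simp add: Suc mult.assoc)
qed simp

lemma e_pow_f_pow:
  "4 ^ k * (e ^ k * f ^ k) = pev (pev sc h) c (\<Prod>j<k. [:- ([:0, 1:] - of_nat (1 + 2 * j))\<^sup>2, 1:])"
proof (induction k)
  case (Suc k)
  let ?h = "h - of_nat (1 + 2 * k)"
  have sh: "(h - 1) * f ^ k = f ^ k * ?h" using h_f_pow[of k] by (simp add: algebra_simps)
  have "4 ^ Suc k * (e ^ Suc k * f ^ Suc k) = 4 ^ k * (e ^ k * (4 * (e * f) * f ^ k))"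
  proof -
    have "x * (4 * y) = 4 * (x * y)" for x y :: 'a
      using sc_left_commute[of x 4 y] by (simp add: sc_numeral)
    moreover have "(4::'a) ^ Suc k = 4 ^ k * 4" by (rule power_Suc2)
    ultimately show ?thesis unfolding power_Suc[of f] power_Suc2[of e] by (simp only: mult.assoc)
  qed
  \<comment> \<open>The innermost pair e f is traded for c and -(h - 1)^2; moving
    \<open>f ^ k\<close> to the left then turns h - 1 into h - 1 - 2 k and leaves c
    unchanged.\<close>
  also have "4 * (e * f) * f ^ k = c * f ^ k - (h - 1) * ((h - 1) * f ^ k)"
    by (simp add: c_def power2_eq_square algebra_simps)
  also have "\<dots> = f ^ k * c - f ^ k * ?h * ?h"
    unfolding c_f_pow sh by (simp only: sh flip: mult.assoc)
  also have "4 ^ k * (e ^ k * (f ^ k * c - f ^ k * ?h * ?h)) = 4 ^ k * (e ^ k * f ^ k) * (c - ?h\<^sup>2)"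
  proof -
    have "a * (b * (u * c - u * v * v)) = a * (b * u) * (c - v * v)" for a b u v :: 'a
      by (simp add: algebra_simps)
    then show ?thesis by (simp only: power2_eq_square)
  qed
  also have "c - ?h\<^sup>2 = pev (pev sc h) c [:- ([:0, 1:] - of_nat (1 + 2 * k))\<^sup>2, 1:]"
    by (simp only: PB.pev_pCons PB.pev_0 PH.pev_minus PH.pev_power PH.pev_diff PH.pev_X PH.pev_of_nat PH.pev_1) simp
  finally show ?case unfolding Suc by (simp only: prod.lessThan_Suc PB.pev_mult)
qed simp

text \<open>An identity prior to reduction by d: the product formula for 4^p e^p f^p is collapsed
  over k[h] with y = h. The shifts 1 + 2 j meet each residue once because 2 is invertible modulo p,
  and 2 h is not a constant.\<close>

lemma Phi_c: "pev sc c (Phi p) - (h ^ p - h)\<^sup>2 = 4 ^ p * (e ^ p * f ^ p)"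
proof -
  let ?Y = "[:0, 1:] :: 'k poly"
  have C: "CHAR('k poly) = p" using p by simp
  have inj: "inj_on (\<lambda>j. of_nat (1 + 2 * j) :: 'k poly) {..<p}"
  proof (rule inj_onI)
    fix i j assume ij: "i \<in> {..<p}" "j \<in> {..<p}" "(of_nat (1 + 2 * i) :: 'k poly) = of_nat (1 + 2 * j)"
    have "[1 + 2 * i = 1 + 2 * j] (mod p)" using ij(3) C of_nat_eq_iff_cong_CHAR by metis
    then have "[2 * i = 2 * j] (mod p)" by (simp only: cong_add_lcancel_nat)
    moreover have "coprime 2 p" using odd_p[OF p] by simp
    ultimately have "[i = j] (mod p)" using cong_mult_lcancel_nat by blast
    then show "i = j" using ij by (simp add: cong_def)
  qed
  have Y: "2 * ?Y \<noteq> of_nat n" for n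
  proof
    assume "2 * ?Y = of_nat n"
    then have "Polynomial.coeff (2 * ?Y) 1 = Polynomial.coeff (of_nat n) 1" by simp
    then show False using two_nonzero[OF p] by (simp add: of_nat_poly numeral_poly)
  qed
  have "4 ^ p * (e ^ p * f ^ p) = pev (pev sc h) c
      (Polynomial.monom 1 p - Polynomial.monom 2 ((p + 1) div 2) + Polynomial.monom 1 1 - [:(?Y ^ p - ?Y)\<^sup>2:])"
    unfolding e_pow_f_pow prod_square_shifts(1)[OF p(1,2) C inj Y] by simp
  also have "\<dots> = c ^ p - 2 * c ^ ((p + 1) div 2) + c - (h ^ p - h)\<^sup>2"
  proof -
    have two: "pev sc h 2 = 2" using PH.pev_of_nat[of 2] by simp
    show ?thesis
      by (simp only: PB.pev_add PB.pev_diff PB.pev_monom PB.pev_const PH.pev_power PH.pev_diff PH.pev_X PH.pev_1 two) simp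
  qed
  also have "c ^ p - 2 * c ^ ((p + 1) div 2) + c = pev sc c (Phi p)"
    unfolding Phi_def by (simp add: PC.pev_add PC.pev_diff PC.pev_monom sc_one sc_numeral)
  finally show ?thesis by simp
qed

lemma Phi_c_zero: "d * pev sc c (Phi p - [:s\<^sup>2:]) = 0"
proof -
  have "d * (4 ^ p * (e ^ p * f ^ p)) = 4 ^ p * (d * e ^ p * f ^ p)"
    using d_left_commute[of "4 ^ p" "e ^ p * f ^ p"] by (simp add: mult.assoc)
  moreover have "pev sc c (Phi p) = (h ^ p - h) * (h ^ p - h) + 4 ^ p * (e ^ p * f ^ p)"
    using Phi_c by (simp only: power2_eq_square diff_eq_eq add.commute)
  ultimately have "d * pev sc c (Phi p) = d * (h ^ p - h) * (h ^ p - h)"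
    by (simp add: e_p distrib_left mult.assoc)
  also have "\<dots> = d * sc s * (h ^ p - h)" by (simp only: h_p)
  also have "\<dots> = sc s * (d * (h ^ p - h))" by (simp only: mult.assoc sc_left_commute)
  also have "\<dots> = d * sc (s\<^sup>2)" unfolding h_p by (simp only: power2_eq_square sc_mult sc_left_commute)
  finally show ?thesis by (simp add: PC.pev_diff PC.pev_const right_diff_distrib)
qed

text \<open>The only route by which the polynomial congruences of the idempotents become equations
  in the reduced algebra.\<close>

lemma pev_c_zero_mod:
  assumes "Phi p - [:s\<^sup>2:] dvd q" shows "d * pev sc c q = 0"
  using assms Phi_c_zero by (auto simp: PC.pev_mult elim!: dvdE simp flip: mult.assoc)

lemma G_mult: "x \<in> G \<Longrightarrow> y \<in> G \<Longrightarrow> x * y \<in> G"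
  by (induction rule: G.induct) (auto simp: distrib_right mult.assoc intro: G.intros)

lemma G_gens: "e \<in> G" "f \<in> G" "h \<in> G" "sc a \<in> G"
  using G_e[OF G_one] G_f[OF G_one] G_h[OF G_one] G_sc[OF G_one] by simp_all

lemma G_zero: "0 \<in> G"
  using G_sc[OF G_one, of 0] by simp

lemma G_minus: "x \<in> G \<Longrightarrow> - x \<in> G"
  using G_sc[of x "-1"] by (simp add: sc_minus sc_one)

lemma G_diff: "x \<in> G \<Longrightarrow> y \<in> G \<Longrightarrow> x - y \<in> G"
  using G_add[of x "- y"] by (simp add: G_minus)

lemma G_pow: "x \<in> G \<Longrightarrow> x ^ n \<in> G"
  by (induction n) (auto intro: G_mult G_one)

lemma G_of_nat: "of_nat n \<in> G"
  using G_gens(4)[of "of_nat n"] by (simp add: sc_of_nat)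

lemma G_pev_h: "pev sc h q \<in> G"
  by (induction q) (auto simp: PH.pev_pCons intro: G_add G_h G_gens G_zero)

lemma G_c: "c \<in> G"
  using G_gens(4)[of 4] unfolding c_def by (auto simp: sc_numeral intro!: G_add G_pow G_diff G_mult G_gens G_one)

lemma G_comm_c: "x \<in> G \<Longrightarrow> x * c = c * x"
proof (induction rule: G.induct)
  case (G_e x)
  have "c * (e * x) = e * (c * x)" using c_e by (simp flip: mult.assoc)
  then show ?case using G_e by (simp add: mult.assoc)
next
  case (G_f x)
  have "c * (f * x) = f * (c * x)" using c_f by (simp flip: mult.assoc)
  then show ?case using G_f by (simp add: mult.assoc)
next
  case (G_h x)
  have "c * (h * x) = h * (c * x)" using c_h by (simp flip: mult.assoc)
  then show ?case using G_h by (simp add: mult.assoc)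
next
  case (G_sc x a)
  then show ?case by (simp add: mult.assoc sc_left_commute[of c])
qed (simp_all add: algebra_simps)

lemma pev_c_comm: "x \<in> G \<Longrightarrow> pev sc c q * x = x * pev sc c q"
  by (rule PC.pev_commute[symmetric]) (simp_all add: G_comm_c sc_comm[symmetric])

section \<open>Highest weight vectors inside left ideals of the algebra\<close>

definition hw :: "'k \<Rightarrow> 'a \<Rightarrow> bool" where
  "hw l v \<longleftrightarrow> e * v = 0 \<and> h * v = sc l * v \<and> d * v = v"

text \<open>Since e h = (h - 2) e, the kernel of e is stable under h.\<close>

lemma ker_e_pev_h: "e * y = 0 \<Longrightarrow> e * (pev sc h q * y) = 0"
  by (induction q) (simp_all add: PH.pev_pCons distrib_left distrib_right mult.assoc nf_assoc sc_left_commute[of e])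

lemma artin_schreier_split:
  assumes "y ^ p - y = s"
  shows "Polynomial.monom 1 p - [:s, 1:] = (\<Prod>j<p. [:- (y - of_nat j), 1:])" (is "?q = _")
proof -
  have inj: "inj_on (\<lambda>j. y - of_nat j) {..<p}"
    using of_nat_inj_on_CHAR[OF p(3)] by (simp add: inj_on_def)
  have a: "Polynomial.coeff ?q i = (if i = p then 1 else 0)" if "i \<ge> p" for i
  proof -
    have "Polynomial.coeff [:s, 1:] i = 0" by (rule coeff_eq_0) (use that p(2) in auto)
    then show ?thesis using that by simp
  qed
  have co: "Polynomial.coeff ?q p = 1" by (metis a le_refl)
  have co': "Polynomial.coeff ?q i = 0" if "i > p" for i using that by (metis a less_imp_le less_irrefl_nat)
  have dg: "degree ?q = p" using co co' by (intro antisym degree_le le_degree) auto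
  have "?q = (\<Prod>x\<in>(\<lambda>j. y - of_nat j) ` {..<p}. [:-x, 1:])"
  proof (rule monic_eq_prod_roots)
    fix x assume "x \<in> (\<lambda>j. y - of_nat j) ` {..<p}"
    then obtain j where "x = y - of_nat j" by auto
    then have "x ^ p - x = s"
      using artin_schreier_shift[of y j] p assms by simp
    then show "poly ?q x = 0" by (simp add: poly_monom algebra_simps)
  qed (use dg co inj in \<open>simp_all add: card_image\<close>)
  then show ?thesis using inj by (simp add: prod.reindex)
qed

text \<open>The vector is returned in the form d u w with u in \<open>G\<close>, so that for w in a
  two-sided ideal it still belongs to that ideal after reduction.\<close>

lemma ex_hw:
  assumes "d * w \<noteq> 0"
  obtains u l where "u \<in> G" "hw l (d * (u * w))" "d * (u * w) \<noteq> 0" "l ^ p - l = s"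
proof -
  have "e ^ p * (d * w) = 0" using d_left_commute[of "e ^ p" w] e_p by (simp flip: mult.assoc)
  \<comment> \<open>The last nonzero term of the chain d w, e d w, e^2 d w, ... is killed by
    e.\<close>
  then have "\<exists>k<p. (\<forall>i\<le>k. e ^ i * (d * w) \<noteq> 0) \<and> e ^ Suc k * (d * w) = 0"
    using assms by (intro ex_least_nat_less) auto
  then obtain k where k: "e ^ k * (d * w) \<noteq> 0" "e * (e ^ k * (d * w)) = 0" by (auto simp: mult.assoc)
  define y where "y = e ^ k * (d * w)"
  obtain r where r: "r ^ p - r = s" using root by blast
  let ?P = "\<lambda>n. pev sc h (\<Prod>j<n. [:- (r - of_nat j), 1:])"
  have dy: "d * y = y" unfolding y_def d_left_commute[of "e ^ k"] by (rule d_d)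
  have "?P p = h ^ p - (sc s + h)"
    unfolding artin_schreier_split[OF r, symmetric]
    by (simp add: PH.pev_diff PH.pev_monom PH.pev_pCons sc_one)
  then have "?P p * y = (h ^ p - h) * (d * y) - sc s * (d * y)"
    unfolding dy by (simp only: left_diff_distrib distrib_right) simp
  also have "\<dots> = d * (h ^ p - h) * y - d * sc s * y" by (simp only: d_left_commute mult.assoc)
  finally have "?P p * y = 0" by (simp add: h_p)
  \<comment> \<open>The factors h - (r - j) are applied to y one at a time; the last nonzero partial
    product is an eigenvector of h for the next root r - n.\<close>
  then have "\<exists>n<p. (\<forall>i\<le>n. ?P i * y \<noteq> 0) \<and> ?P (Suc n) * y = 0"
    using k(1) by (intro ex_least_nat_less) (auto simp: y_def)
  then obtain n where n: "?P n * y \<noteq> 0" "?P (Suc n) * y = 0" by auto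
  let ?l = "r - of_nat n"
  let ?v = "?P n * y"
  have "?P (Suc n) = ?P n * (- sc ?l + h)"
    by (simp only: prod.lessThan_Suc PH.pev_mult PH.pev_pCons PH.pev_0 sc_minus sc_one mult_zero_right mult_1_right add_0_right)
  moreover have "?P n * (- sc ?l + h) = (- sc ?l + h) * ?P n"
    using PH.pev_commute[of "- sc ?l + h"] by (simp add: sc_comm[of _ h] sc_comm[of _ "sc _"] algebra_simps)
  ultimately have "(- sc ?l + h) * ?v = 0" using n(2) by (simp only: mult.assoc[symmetric])
  then have hv: "h * ?v = sc ?l * ?v" by (simp add: algebra_simps)
  have u: "?v = d * ((?P n * e ^ k) * w)"
    unfolding y_def d_left_commute[of "e ^ k"] d_left_commute[of "?P n"] by (simp only: mult.assoc)
  have dv: "d * ?v = ?v" using d_left_commute[of "?P n" y] dy by simp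
  show thesis
  proof (rule that)
    show "?P n * e ^ k \<in> G" by (intro G_mult G_pow G_pev_h G_gens)
    show "hw ?l (d * ((?P n * e ^ k) * w))" unfolding u[symmetric] hw_def
      using hv ker_e_pev_h[OF k(2)[folded y_def]] dv by blast
    show "d * ((?P n * e ^ k) * w) \<noteq> 0" unfolding u[symmetric] by (rule n(1))
    show "?l ^ p - ?l = s" using artin_schreier_shift[of r n] p r by simp
  qed
qed

lemma c_hw: assumes "hw l v" shows "c * v = sc ((l + 1)\<^sup>2) * v"
proof -
  have v: "e * v = 0" "h * v = sc l * v" using assms by (auto simp: hw_def)
  have "c * v = h * (h * v) + h * v + h * v + v"
    unfolding c_nf by (simp add: distrib_right mult.assoc v)
  also have "\<dots> = sc (l * l + l + l + 1) * v"
    unfolding sc_add sc_mult sc_one by (simp add: v sc_left_commute[of h] distrib_right mult.assoc)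
  also have "l * l + l + l + 1 = (l + 1)\<^sup>2" by (simp add: power2_eq_square algebra_simps)
  finally show ?thesis .
qed

lemma pev_c_hw: "hw l v \<Longrightarrow> pev sc c q * v = sc (poly q ((l + 1)\<^sup>2)) * v"
  by (induction q) (simp_all add: PC.pev_pCons distrib_right mult.assoc sc_add sc_mult c_hw sc_left_commute[of c] sc_left_commute[of "sc ((l + 1)\<^sup>2)"])

text \<open>The left ideal (modulo the reduction) whose quotient is the baby Verma module of highest weight \<open>l\<close>.\<close>

definition L :: "'k \<Rightarrow> 'a set" where
  "L l = {y. \<exists>a\<in>G. \<exists>b\<in>G. d * y = d * (a * e + b * (h - sc l))}"

section \<open>Baby Verma modules, treated as congruences modulo the left ideals
  \<open>L l\<close>\<close>

lemma LI: "a \<in> G \<Longrightarrow> b \<in> G \<Longrightarrow> y = a * e + b * (h - sc l) \<Longrightarrow> y \<in> L l"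
  unfolding L_def by blast

lemma L_cong: "d * y = d * y' \<Longrightarrow> y' \<in> L l \<Longrightarrow> y \<in> L l"
  unfolding L_def by simp

lemma L_zero: "0 \<in> L l"
  by (rule LI[OF G_zero G_zero]) simp

lemma L_add: assumes "x \<in> L l" "y \<in> L l" shows "x + y \<in> L l"
proof -
  obtain a b a' b' where "a \<in> G" "b \<in> G" "a' \<in> G" "b' \<in> G"
    and xy: "d * x = d * (a * e + b * (h - sc l))" "d * y = d * (a' * e + b' * (h - sc l))"
    using assms unfolding L_def by auto
  then have "(a + a') \<in> G" "(b + b') \<in> G" by (auto intro: G_add)
  moreover have "d * (x + y) = d * ((a + a') * e + (b + b') * (h - sc l))"
    unfolding distrib_left[of d x y] xy by (simp only: distrib_left distrib_right add_ac)
  ultimately show ?thesis unfolding L_def by blast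
qed

lemma L_mult: assumes "g \<in> G" "y \<in> L l" shows "g * y \<in> L l"
proof -
  obtain a b where ab: "a \<in> G" "b \<in> G" "d * y = d * (a * e + b * (h - sc l))"
    using assms unfolding L_def by auto
  have "d * (g * y) = g * (d * y)" by (rule d_left_commute[symmetric])
  also have "\<dots> = d * (g * (a * e + b * (h - sc l)))" unfolding ab by (rule d_left_commute)
  finally have "d * (g * y) = d * ((g * a) * e + (g * b) * (h - sc l))" by (simp add: algebra_simps)
  moreover have "g * a \<in> G" "g * b \<in> G" using assms ab by (auto intro: G_mult)
  ultimately show ?thesis unfolding L_def by blast
qed

lemma L_diff: "x \<in> L l \<Longrightarrow> y \<in> L l \<Longrightarrow> x - y \<in> L l"
  using L_add[of x l "- y"] L_mult[OF G_minus[OF G_one], of y l] by simp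

lemma L_sum: "(\<And>i. i \<in> A \<Longrightarrow> g i \<in> L l) \<Longrightarrow> (\<Sum>i\<in>A. g i) \<in> L l"
  by (induction A rule: infinite_finite_induct) (auto intro: L_add L_zero)

text \<open>The universal property of the baby Verma module: a highest weight vector of weight l
  receives a map from the quotient by \<open>L l\<close>.\<close>

lemma L_hw: assumes "hw l v" "y \<in> L l" shows "y * v = 0"
proof -
  obtain a b where ab: "d * y = d * (a * e + b * (h - sc l))" using assms unfolding L_def by auto
  have v: "e * v = 0" "h * v = sc l * v" "d * v = v" using assms by (auto simp: hw_def)
  have "y * v = d * y * v" using d_left_commute[of y v] v(3) by (simp add: mult.assoc)
  also have "\<dots> = d * (a * (e * v) + b * (h * v - sc l * v))" unfolding ab by (simp add: algebra_simps)
  finally show ?thesis by (simp add: v)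
qed

text \<open>Elements whose class in the baby Verma module is a combination of 1, f, ..., f^(p-1).
  Closure under the generators will show that this is all of \<open>G\<close>.\<close>

definition S :: "'k \<Rightarrow> 'a set" where
  "S l = {x. \<exists>r. x - (\<Sum>i<p. sc (r i) * f ^ i) \<in> L l}"

lemma L_S: "x \<in> L l \<Longrightarrow> x \<in> S l"
  unfolding S_def by (auto intro!: exI[of _ "\<lambda>_. 0"])

lemma S_add: assumes "x \<in> S l" "y \<in> S l" shows "x + y \<in> S l"
proof -
  obtain r r' where "x - (\<Sum>i<p. sc (r i) * f ^ i) \<in> L l" "y - (\<Sum>i<p. sc (r' i) * f ^ i) \<in> L l"
    using assms unfolding S_def by auto
  from L_add[OF this] have "x + y - (\<Sum>i<p. sc (r i + r' i) * f ^ i) \<in> L l"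
    by (simp add: sc_add algebra_simps sum.distrib)
  then show ?thesis unfolding S_def by (auto intro!: exI[of _ "\<lambda>i. r i + r' i"])
qed

lemma S_sc: assumes "x \<in> S l" shows "sc a * x \<in> S l"
proof -
  obtain r where "x - (\<Sum>i<p. sc (r i) * f ^ i) \<in> L l" using assms unfolding S_def by auto
  from L_mult[OF G_gens(4)[of a] this] have "sc a * x - (\<Sum>i<p. sc (a * r i) * f ^ i) \<in> L l"
    by (simp add: sc_mult algebra_simps sum_distrib_left)
  then show ?thesis unfolding S_def by (auto intro!: exI[of _ "\<lambda>i. a * r i"])
qed

lemma S_sum: "(\<And>i. i \<in> A \<Longrightarrow> g i \<in> S l) \<Longrightarrow> (\<Sum>i\<in>A. g i) \<in> S l"
  by (induction A rule: infinite_finite_induct) (auto intro: S_add L_S L_zero)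

lemma S_f_pow: assumes "i < p" shows "f ^ i \<in> S l"
proof -
  have "(\<Sum>j<p. sc (if j = i then 1 else 0) * f ^ j) = (\<Sum>j<p. if j = i then f ^ j else 0)"
    by (intro sum.cong) (auto simp: sc_one)
  then have "(\<Sum>j<p. sc (if j = i then 1 else 0) * f ^ j) = f ^ i" using assms by simp
  then show ?thesis unfolding S_def using L_zero by (auto intro!: exI[of _ "\<lambda>j. if j = i then 1 else 0"])
qed

lemma S_f_pow': assumes "i \<le> p" shows "f ^ i \<in> S l"
proof (cases "i = p")
  case True
  \<comment> \<open>The wrap-around: modulo the reduction, f^p is the scalar t, hence a multiple of
    f^0.\<close>
  have "f ^ p - sc t \<in> L l" by (rule L_cong[OF _ L_zero]) (simp add: f_p right_diff_distrib)
  then have "f ^ p - sc t + sc t * f ^ 0 \<in> S l" using p(2) by (intro S_add L_S S_sc S_f_pow) auto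
  then show ?thesis using True by simp
qed (use assms S_f_pow in simp)

lemma S_left_mult:
  assumes "g \<in> G" "x \<in> S l" "\<And>i. i < p \<Longrightarrow> g * f ^ i \<in> S l"
  shows "g * x \<in> S l"
proof -
  obtain r where r: "x - (\<Sum>i<p. sc (r i) * f ^ i) \<in> L l" using assms unfolding S_def by auto
  have eq: "g * x = g * (x - (\<Sum>i<p. sc (r i) * f ^ i)) + (\<Sum>i<p. sc (r i) * (g * f ^ i))"
    by (simp add: algebra_simps sum_distrib_left sc_left_commute[of g])
  show ?thesis unfolding eq
    by (intro S_add S_sum S_sc L_S[OF L_mult[OF assms(1) r]] assms(3)) simp
qed

lemma h_f_pow_L: "h * f ^ i - sc (l - of_nat (2 * i)) * f ^ i \<in> L l"
proof (rule LI[OF G_zero G_pow[OF G_gens(2)]])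
  show "h * f ^ i - sc (l - of_nat (2 * i)) * f ^ i = 0 * e + f ^ i * (h - sc l)"
    unfolding h_f_pow sc_comm[of _ "f ^ i"] by (simp only: sc_diff sc_of_nat right_diff_distrib) simp
qed

lemma e_f_pow_L: "e * f ^ Suc i - sc (of_nat (Suc i) * (l - of_nat i)) * f ^ i \<in> L l"
proof (rule LI)
  show "f ^ Suc i \<in> G" "f ^ i * of_nat (Suc i) \<in> G" by (intro G_mult G_pow G_gens G_of_nat)+
  have "sc (of_nat (Suc i) * (l - of_nat i)) * f ^ i = f ^ i * (of_nat (Suc i) * (sc l - of_nat i))"
    by (subst sc_comm) (simp only: sc_mult sc_diff sc_of_nat)
  then show "e * f ^ Suc i - sc (of_nat (Suc i) * (l - of_nat i)) * f ^ i = f ^ Suc i * e + f ^ i * of_nat (Suc i) * (h - sc l)"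
    unfolding e_f_pow by (simp only: mult.assoc right_diff_distrib) simp
qed

lemma G_S: "x \<in> G \<Longrightarrow> x \<in> S l"
proof (induction rule: G.induct)
  case G_one
  then show ?case using S_f_pow[of 0] p(2) by simp
next
  case (G_e x)
  have "e * f ^ i \<in> S l" if i: "i < p" for i
  proof (cases i)
    case 0
    have "e \<in> L l" by (rule LI[OF G_one G_zero]) simp
    then show ?thesis using 0 by (simp add: L_S)
  next
    case (Suc j)
    have "e * f ^ i - sc (of_nat (Suc j) * (l - of_nat j)) * f ^ j + sc (of_nat (Suc j) * (l - of_nat j)) * f ^ j \<in> S l"
      using i unfolding Suc by (intro S_add L_S e_f_pow_L S_sc S_f_pow) auto
    then show ?thesis by simp
  qed
  then show ?case by (rule S_left_mult[OF G_gens(1) G_e.IH])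
next
  case (G_f x)
  have "f * f ^ i \<in> S l" if i: "i < p" for i using S_f_pow'[of "Suc i"] i by simp
  then show ?case by (rule S_left_mult[OF G_gens(2) G_f.IH])
next
  case (G_h x)
  have "h * f ^ i \<in> S l" if i: "i < p" for i
  proof -
    have "h * f ^ i - sc (l - of_nat (2 * i)) * f ^ i + sc (l - of_nat (2 * i)) * f ^ i \<in> S l"
      using i by (intro S_add L_S h_f_pow_L S_sc S_f_pow)
    then show ?thesis by simp
  qed
  then show ?case by (rule S_left_mult[OF G_gens(3) G_h.IH])
qed (auto intro: S_sc S_add)

lemma pev_h_f_pow_L: "pev sc h q * f ^ i - sc (poly q (l - of_nat (2 * i))) * f ^ i \<in> L l"
proof (induction q)
  case (pCons a q)
  let ?z = "l - of_nat (2 * i)"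
  have "pev sc h (pCons a q) * f ^ i - sc (poly (pCons a q) ?z) * f ^ i
      = h * (pev sc h q * f ^ i - sc (poly q ?z) * f ^ i) + sc (poly q ?z) * (h * f ^ i - sc ?z * f ^ i)"
    unfolding PH.pev_pCons poly_pCons sc_add sc_mult
    by (simp only: distrib_right right_diff_distrib mult.assoc sc_left_commute[of h] sc_left_commute[of "sc ?z" "poly q ?z"]) simp
  then show ?case using pCons h_f_pow_L by (auto intro!: L_add L_mult G_gens)
qed (simp add: L_zero)

text \<open>The \<open>l\<close>-weight space of the baby Verma module is one-dimensional. No basis of the module is
  needed: the polynomial \<open>P\<close> in \<open>h\<close> projects onto that weight space.\<close>

lemma commutes_h_scalar_mod_L:
  assumes "x \<in> G" "d * (x * h) = d * (h * x)"
  shows "\<exists>r. x - sc r \<in> L l"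
proof -
  \<comment> \<open>P vanishes at the weights l - 2 i of f^i for 0 < i < p, while P(l) is the
    product of the 2 i, which is nonzero in k. So P(h) keeps only the component along f^0.\<close>
  define P where "P = (\<Prod>i\<in>{1..<p}. [:- (l - of_nat (2 * i)), 1:])"
  have P0: "poly P (l - of_nat (2 * i)) = 0" if "i \<in> {1..<p}" for i
    using that by (auto simp: P_def poly_prod)
  have "poly P l = (\<Prod>i\<in>{1..<p}. 2 * of_nat i)" by (simp add: P_def poly_prod)
  then have Pl: "poly P l \<noteq> 0" using two_nonzero[OF p] of_nat_nonzero[OF p] by auto
  have comm: "d * (x * pev sc h q) = d * (pev sc h q * x)" for q
  proof (induction q)
    case (pCons a q)
    have "d * (x * (h * pev sc h q)) = d * (x * h) * pev sc h q" by (simp add: mult.assoc)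
    also have "\<dots> = h * (d * (x * pev sc h q))"
      unfolding assms(2) d_left_commute[of h] by (simp only: mult.assoc)
    also have "\<dots> = d * (h * (pev sc h q * x))" unfolding pCons by (rule d_left_commute)
    finally show ?case by (simp add: PH.pev_pCons distrib_left distrib_right sc_comm[of _ x] mult.assoc)
  qed simp
  obtain r where r: "x - (\<Sum>i<p. sc (r i) * f ^ i) \<in> L l" using G_S[OF assms(1)] unfolding S_def by auto
  have a: "pev sc h P * (x - (\<Sum>i<p. sc (r i) * f ^ i)) \<in> L l" by (intro L_mult G_pev_h r)
  have b: "(\<Sum>i<p. sc (r i) * (pev sc h P * f ^ i - sc (poly P (l - of_nat (2 * i))) * f ^ i)) \<in> L l"
    by (intro L_sum L_mult G_gens pev_h_f_pow_L)
  have "(\<Sum>i<p. sc (r i) * (sc (poly P (l - of_nat (2 * i))) * f ^ i)) = (\<Sum>i\<in>{0}. sc (r i) * (sc (poly P (l - of_nat (2 * i))) * f ^ i))"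
  proof (rule sum.mono_neutral_right)
    show "\<forall>i\<in>{..<p} - {0}. sc (r i) * (sc (poly P (l - of_nat (2 * i))) * f ^ i) = 0"
      using P0 by (auto simp del: of_nat_mult)
  qed (use p in auto)
  then have "pev sc h P * (x - (\<Sum>i<p. sc (r i) * f ^ i))
      + (\<Sum>i<p. sc (r i) * (pev sc h P * f ^ i - sc (poly P (l - of_nat (2 * i))) * f ^ i))
      = pev sc h P * x - sc (r 0) * sc (poly P l)"
    by (simp add: right_diff_distrib sum_distrib_left sum_subtractf sc_left_commute[of "pev sc h P"])
  then have c1: "pev sc h P * x - sc (r 0) * sc (poly P l) \<in> L l" using L_add[OF a b] by simp
  \<comment> \<open>P(h) is congruent to P(l) modulo a left ideal, so multiplying by x on the left
    gives x P(h) congruent to P(l) x. Comparing with P(h) x yields P(l) (x - r_0) in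
    \<open>L l\<close>.\<close>
  have c2: "x * (pev sc h P * f ^ 0 - sc (poly P (l - of_nat (2 * 0))) * f ^ 0) \<in> L l"
    by (intro L_mult assms pev_h_f_pow_L)
  have c3: "pev sc h P * x - x * pev sc h P \<in> L l"
    by (rule L_cong[OF _ L_zero]) (simp add: right_diff_distrib comm)
  have "(pev sc h P * x - sc (r 0) * sc (poly P l)) - (pev sc h P * x - x * pev sc h P)
      - x * (pev sc h P * f ^ 0 - sc (poly P (l - of_nat (2 * 0))) * f ^ 0) = sc (poly P l) * (x - sc (r 0))"
    using sc_comm[of "r 0" "sc (poly P l)"] by (simp add: right_diff_distrib sc_comm[of _ x])
  then have "sc (poly P l) * (x - sc (r 0)) \<in> L l" using L_diff[OF L_diff[OF c1 c3] c2] by simp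
  from L_mult[OF G_gens(4)[of "inverse (poly P l)"] this] have "sc (inverse (poly P l) * poly P l) * (x - sc (r 0)) \<in> L l"
    by (simp only: sc_mult mult.assoc)
  then have "x - sc (r 0) \<in> L l" using Pl by (simp add: sc_one)
  then show ?thesis by blast
qed

lemma pev_c_L: "pev sc c q - sc (poly q ((l + 1)\<^sup>2)) \<in> L l"
proof (induction q)
  case (pCons a q)
  have c: "c - sc ((l + 1)\<^sup>2) \<in> L l"
  proof (rule LI)
    show "f + f + f + f \<in> G" "h + sc l + 1 + 1 \<in> G" by (intro G_add G_gens G_one)+
    \<comment> \<open>From c = (h + 1)^2 + 4 f e and (h + 1)^2 - (l + 1)^2 = (h + l + 2) (h -
      l).\<close>
    show "c - sc ((l + 1)\<^sup>2) = (f + f + f + f) * e + (h + sc l + 1 + 1) * (h - sc l)"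
    proof -
      have sq: "(l + 1)\<^sup>2 = l * l + l + l + 1" by (simp add: power2_eq_square algebra_simps)
      show ?thesis unfolding c_nf sq sc_add sc_mult sc_one by (simp add: sc_comm[of l h] algebra_simps)
    qed
  qed
  let ?r = "sc (poly q ((l + 1)\<^sup>2))"
  have "pev sc c (pCons a q) - sc (poly (pCons a q) ((l + 1)\<^sup>2)) = c * (pev sc c q - ?r) + ?r * (c - sc ((l + 1)\<^sup>2))"
    unfolding PC.pev_pCons poly_pCons sc_add sc_mult[of "(l + 1)\<^sup>2"] right_diff_distrib
    using sc_comm[of "poly q ((l + 1)\<^sup>2)" c] sc_comm[of "poly q ((l + 1)\<^sup>2)" "sc ((l + 1)\<^sup>2)"] by simp
  then show ?case using pCons c by (auto intro!: L_add L_mult G_c G_gens)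
qed (simp add: L_zero)

end

text \<open>Adds the single nonvanishing input: the classes of f^m, m < p, in the baby Verma modules
  are nonzero. It is later verified on explicit matrices.\<close>

locale sl2_alg_faithful = sl2_alg e f h d sc p s t
  for e f h d :: "'a::ring_1" and sc :: "'k::field \<Rightarrow> 'a" and p :: nat and s t :: 'k +
  assumes f_pow_notin_L: "l ^ p - l = s \<Longrightarrow> m < p \<Longrightarrow> f ^ m \<notin> L l"
begin

text \<open>On the baby Verma module of weight l this element acts by 1, so its vanishing would put
  1 = f^0 into \<open>L l\<close>.\<close>

lemma pev_c_nonzero:
  assumes "l ^ p - l = s" "poly q ((l + 1)\<^sup>2) = 1"
  shows "d * pev sc c q \<noteq> 0"
proof
  assume "d * pev sc c q = 0"
  then have "pev sc c q \<in> L l" using L_cong[OF _ L_zero] by simp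
  then have "1 \<in> L l" using L_diff[OF _ pev_c_L[of q l]] assms(2) by (fastforce simp: sc_one)
  then show False using f_pow_notin_L[OF assms(1), of 0] p(2) by simp
qed

text \<open>If \<open>l1 \<noteq> l2\<close> then \<open>l1 = m - 1\<close> in the prime field and \<open>f ^ m\<close> is a highest weight vector of weight
  \<open>l2\<close> in the baby Verma module of weight \<open>l1\<close>, on which \<open>x\<close> acts both as 1 and as 0.\<close>

lemma linked_weights:
  assumes x: "x \<in> G" "d * (x * h) = d * (h * x)" "d * (x * f) = d * (f * x)"
    and v1: "hw l1 v1" "v1 \<noteq> 0" "x * v1 = v1" "l1 ^ p - l1 = s"
    and v2: "hw l2 v2" "v2 \<noteq> 0" "x * v2 = 0" "l2 ^ p - l2 = s"
    and linked: "(l1 + 1)\<^sup>2 = (l2 + 1)\<^sup>2"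
  shows False
proof -
  obtain r1 where r1: "x - sc r1 \<in> L l1" using commutes_h_scalar_mod_L[OF x(1,2)] by blast
  have "sc (1 - r1) * v1 = 0" using L_hw[OF v1(1) r1] v1(3) by (simp add: sc_diff sc_one algebra_simps)
  then have r1_1: "r1 = 1" using sc_cancel v1(2) by (metis right_minus_eq)
  obtain r2 where r2: "x - sc r2 \<in> L l2" using commutes_h_scalar_mod_L[OF x(1,2)] by blast
  have "sc r2 * v2 = 0" using L_hw[OF v2(1) r2] v2(3) by (simp add: algebra_simps)
  then have "r2 = 0" using sc_cancel v2(2) by metis
  then obtain a b where ab: "a \<in> G" "b \<in> G" "d * x = d * (a * e + b * (h - sc l2))"
    using r2 unfolding L_def by auto
  have "l1 \<noteq> l2"
  proof
    assume "l1 = l2"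
    then have "(x - sc r1) * v2 = 0" using L_hw v2(1) r1 by blast
    then show False using v2 r1_1 by (simp add: sc_one algebra_simps)
  qed
  moreover have "l1 + 1 = l2 + 1 \<or> l1 + 1 = - (l2 + 1)" using linked by (simp only: power2_eq_iff)
  ultimately have neg: "l1 + 1 = - (l2 + 1)" by simp
  define z where "z = l1 + 1"
  have l12: "l1 = z - 1" "l2 = - z - 1" unfolding z_def by simp (simp only: neg, simp)
  have prime: "prime CHAR('k)" using p by simp
  have sh: "y ^ p - y = (y - 1) ^ p - (y - 1)" for y :: 'k
    using artin_schreier_shift[OF prime, of y 1] p(3) by simp
  \<comment> \<open>The weights are z - 1 and -z - 1; shift invariance moves the Artin-Schreier
    equation to z and -z, and p is odd.\<close>
  have z: "z ^ p - z = s" "(- z) ^ p - (- z) = s"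
    using v1(4) v2(4) unfolding sh[of z] sh[of "- z"] by (simp_all only: l12)
  then have "2 * s = 0" unfolding power_minus_odd[OF odd_p[OF p]] by (simp add: algebra_simps)
  then have s0: "s = 0" using two_nonzero[OF p] by simp
  \<comment> \<open>Taken at -z because the splitting lists the roots as 0 - j; so -z = -m gives z =
    m.\<close>
  then have rt: "poly (Polynomial.monom 1 p - [:s, 1:]) (- z) = 0" using z(2) by (simp add: poly_monom)
  have "(0::'k) ^ p - 0 = s" using s0 p by (simp add: zero_power)
  from rt obtain m where m: "m < p" "z = of_nat m"
    unfolding artin_schreier_split[OF \<open>0 ^ p - 0 = s\<close>] by (auto simp: poly_prod)
  have "m \<noteq> 0" using m \<open>l1 \<noteq> l2\<close> l12 by (intro notI) simp
  then obtain i where i: "m = Suc i" by (cases m) auto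
  have l1: "l1 = of_nat i" using m(2) i l12 by simp
  have l2: "l2 = l1 - of_nat (2 * m)" using l12 m(2) by simp
  \<comment> \<open>Here m = i + 1 and l1 = i, so the coefficient (i + 1) (l1 - i) vanishes.\<close>
  have "e * f ^ m \<in> L l1" using e_f_pow_L[of i l1] unfolding i by (simp add: l1)
  moreover have "(h - sc l2) * f ^ m \<in> L l1" using h_f_pow_L[of m l1] unfolding l2 by (simp only: left_diff_distrib)
  ultimately have "a * (e * f ^ m) + b * ((h - sc l2) * f ^ m) \<in> L l1"
    by (intro L_add L_mult[OF ab(1)] L_mult[OF ab(2)])
  moreover have "d * (x * f ^ m) = d * (a * (e * f ^ m) + b * ((h - sc l2) * f ^ m))"
    using arg_cong[OF ab(3), of "\<lambda>y. y * f ^ m"] by (simp only: distrib_right mult.assoc)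
  ultimately have xf: "x * f ^ m \<in> L l1" using L_cong by blast
  have comm: "d * (x * f ^ n) = d * (f ^ n * x)" for n
  proof (induction n)
    case (Suc n)
    have "d * (x * f ^ Suc n) = d * (x * f) * f ^ n" by (simp add: mult.assoc)
    also have "\<dots> = f * (d * (x * f ^ n))"
      unfolding x(3) d_left_commute[of f] by (simp only: mult.assoc)
    also have "\<dots> = d * (f ^ Suc n * x)" unfolding Suc d_left_commute[of f] by (simp add: mult.assoc)
    finally show ?case .
  qed simp
  \<comment> \<open>The two actions collide: x f^m is 0 modulo \<open>L l1\<close> through weight
    l2, and it is also f^m x, hence f^m, through weight l1.\<close>
  have A: "x * f ^ m - f ^ m * x \<in> L l1"
    by (rule L_cong[OF _ L_zero]) (simp add: right_diff_distrib comm)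
  have "f ^ m * (x - sc r1) \<in> L l1" by (intro L_mult G_pow G_gens r1)
  from L_diff[OF L_diff[OF xf A] this] have "x * f ^ m - (x * f ^ m - f ^ m * x) - f ^ m * (x - sc r1) \<in> L l1" .
  moreover have "x * f ^ m - (x * f ^ m - f ^ m * x) - f ^ m * (x - sc r1) = f ^ m"
    by (simp add: r1_1 sc_one right_diff_distrib)
  ultimately have "f ^ m \<in> L l1" by (simp only:)
  then show False using f_pow_notin_L v1(4) m(1) by blast
qed

end

section \<open>The free algebra and its quotients\<close>

lemma fa_mult_Nil [simp]: "fa_mult x y [] = x [] * y []"
  by (simp add: fa_mult_def)

text \<open>Either the cut is before the first letter or that letter belongs to the left factor.
  Associativity follows by induction on the word with x arbitrary, since x changes to its shift by a
  letter.\<close>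

lemma fa_mult_Cons: "fa_mult x y (a # w) = x [] * y (a # w) + fa_mult (\<lambda>v. x (a # v)) y w"
  unfolding fa_mult_def length_Cons by (subst sum.atMost_Suc_shift) simp

lemma fa_mult_add_left: "fa_mult (fa_add x y) z = fa_add (fa_mult x z) (fa_mult y z)"
  by (simp add: fa_mult_def fa_add_def fun_eq_iff sum.distrib algebra_simps)

lemma fa_mult_add_right: "fa_mult x (fa_add y z) = fa_add (fa_mult x y) (fa_mult x z)"
  by (simp add: fa_mult_def fa_add_def fun_eq_iff sum.distrib algebra_simps)

lemma fa_mult_sub_left: "fa_mult (fa_sub x y) z = fa_sub (fa_mult x z) (fa_mult y z)"
  by (simp add: fa_mult_def fa_sub_def fun_eq_iff sum_subtractf algebra_simps)

lemma fa_mult_sub_right: "fa_mult x (fa_sub y z) = fa_sub (fa_mult x y) (fa_mult x z)"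
  by (simp add: fa_mult_def fa_sub_def fun_eq_iff sum_subtractf algebra_simps)

lemma fa_mult_smult_left: "fa_mult (fa_smult a x) y = fa_smult a (fa_mult x y)"
  by (simp add: fa_mult_def fa_smult_def fun_eq_iff sum_distrib_left mult.assoc)

lemma fa_mult_smult_right: "fa_mult x (fa_smult a y) = fa_smult a (fa_mult x y)"
  by (simp add: fa_mult_def fa_smult_def fun_eq_iff sum_distrib_left mult.left_commute)

lemma fa_mult_zero_left [simp]: "fa_mult fa_zero x = fa_zero"
  and fa_mult_zero_right [simp]: "fa_mult x fa_zero = fa_zero"
  by (simp_all add: fa_mult_def fa_zero_def)

lemma fa_mult_one_left [simp]: "fa_mult fa_one x = x"
proof
  fix w
  have "(\<lambda>v. fa_one (a # v)) = (fa_zero :: 'a fa)" for a by (simp add: fa_one_def fa_zero_def)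
  then show "fa_mult fa_one x w = x w"
    by (cases w) (simp_all add: fa_mult_Cons fa_one_def fa_zero_def[symmetric], simp add: fa_zero_def)
qed

lemma fa_mult_assoc: "fa_mult (fa_mult x y) z = fa_mult x (fa_mult y z)"
proof
  fix w show "fa_mult (fa_mult x y) z w = fa_mult x (fa_mult y z) w"
  proof (induction w arbitrary: x)
    case (Cons a w)
    have "(\<lambda>v. fa_mult x y (a # v)) = fa_add (fa_smult (x []) (\<lambda>v. y (a # v))) (fa_mult (\<lambda>v. x (a # v)) y)"
      by (simp add: fun_eq_iff fa_mult_Cons fa_add_def fa_smult_def)
    then show ?case
      by (simp add: fa_mult_Cons fa_mult_add_left fa_mult_smult_left Cons.IH) (simp add: fa_add_def fa_smult_def algebra_simps Cons.IH)
  qed simp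
qed

lemma fa_mult_one_right [simp]: "fa_mult x fa_one = x"
proof
  fix w show "fa_mult x fa_one w = x w"
    by (induction w arbitrary: x) (simp_all add: fa_mult_Cons, simp_all add: fa_one_def)
qed

lemma fa_add_zero [simp]: "fa_add fa_zero x = x" "fa_add x fa_zero = x" "fa_sub x fa_zero = x" "fa_sub x x = fa_zero"
  by (simp_all add: fa_add_def fa_sub_def fa_zero_def)

lemma fa_smult_mult: "fa_smult a x = fa_mult (fa_const a) x"
  by (simp add: fa_const_def fa_mult_smult_left)

lemma FA_zero [simp]: "fa_zero \<in> FA"
  by (simp add: FA_def fa_zero_def)

lemma FA_one [simp]: "fa_one \<in> FA"
  by (simp add: FA_def fa_one_def)

lemma FA_gen [simp]: "fa_gen g \<in> FA"
  by (simp add: FA_def fa_gen_def)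

lemma FA_add [simp]: "x \<in> FA \<Longrightarrow> y \<in> FA \<Longrightarrow> fa_add x y \<in> FA"
  unfolding FA_def fa_add_def
  by (auto intro: finite_subset[of _ "{w. x w \<noteq> 0} \<union> {w. y w \<noteq> 0}"])

lemma FA_smult [simp]: "x \<in> FA \<Longrightarrow> fa_smult a x \<in> FA"
  unfolding FA_def fa_smult_def by (auto elim: finite_subset[rotated])

lemma FA_const [simp]: "fa_const a \<in> FA"
  by (simp add: fa_const_def)

lemma fa_sub_alt: "fa_sub x y = fa_add x (fa_smult (-1) y)"
  by (simp add: fa_sub_def fa_add_def fa_smult_def)

lemma FA_sub [simp]: "x \<in> FA \<Longrightarrow> y \<in> FA \<Longrightarrow> fa_sub x y \<in> FA"
  by (simp add: fa_sub_alt)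

lemma FA_mult [simp]:
  assumes "x \<in> FA" "y \<in> FA" shows "fa_mult x y \<in> FA"
proof -
  have "{w. fa_mult x y w \<noteq> 0} \<subseteq> (\<lambda>(u, v). u @ v) ` ({w. x w \<noteq> 0} \<times> {w. y w \<noteq> 0})"
  proof
    fix w assume "w \<in> {w. fa_mult x y w \<noteq> 0}"
    then obtain i where "x (take i w) * y (drop i w) \<noteq> 0"
      unfolding fa_mult_def by (metis (mono_tags, lifting) mem_Collect_eq sum.neutral)
    then show "w \<in> (\<lambda>(u, v). u @ v) ` ({w. x w \<noteq> 0} \<times> {w. y w \<noteq> 0})"
      by (auto intro!: image_eqI[of _ _ "(take i w, drop i w)"])
  qed
  then show ?thesis using assms unfolding FA_def by (auto elim: finite_subset)
qed

lemma FA_pow [simp]: "x \<in> FA \<Longrightarrow> fa_pow x n \<in> FA"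
  by (induction n) auto

lemma fa_setsum_insert: "finite A \<Longrightarrow> a \<notin> A \<Longrightarrow> fa_setsum (insert a A) g = fa_add (g a) (fa_setsum A g)"
  by (simp add: fa_setsum_def fa_add_def)

lemma fa_setsum_empty [simp]: "fa_setsum {} g = fa_zero"
  by (simp add: fa_setsum_def fa_zero_def)

lemma FA_setsum: "finite A \<Longrightarrow> (\<And>a. a \<in> A \<Longrightarrow> g a \<in> FA) \<Longrightarrow> fa_setsum A g \<in> FA"
  by (induction A rule: finite_induct) (auto simp: fa_setsum_insert)

lemma FA_casimir [simp]: "casimir \<in> FA"
  by (simp add: casimir_def)

lemma FA_of_poly [simp]: "fa_of_poly q \<in> FA"
  unfolding fa_of_poly_def by (rule FA_setsum) auto

lemma fa_gen_Nil [simp]: "fa_gen g [] = 0"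
  by (simp add: fa_gen_def)

lemma fa_gen_mult_Cons: "fa_mult (fa_gen g) x (a # w) = (if a = g then x w else 0)"
proof -
  have "(\<lambda>u. fa_gen g (a # u)) = (if a = g then fa_one else fa_zero :: 'a fa)"
    by (auto simp: fa_gen_def fa_one_def fa_zero_def)
  then show ?thesis by (simp add: fa_mult_Cons) (simp add: fa_zero_def)
qed

lemma FA_induct [consumes 1, case_names one gen smult add]:
  assumes "x \<in> FA" "P fa_one" "\<And>g x. x \<in> FA \<Longrightarrow> P x \<Longrightarrow> P (fa_mult (fa_gen g) x)"
    "\<And>a x. x \<in> FA \<Longrightarrow> P x \<Longrightarrow> P (fa_smult a x)"
    "\<And>x y. x \<in> FA \<Longrightarrow> y \<in> FA \<Longrightarrow> P x \<Longrightarrow> P y \<Longrightarrow> P (fa_add x y)"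
  shows "P x"
proof -
  define wd :: "gen list \<Rightarrow> 'a fa" where "wd w = (\<lambda>v. if v = w then 1 else 0)" for w
  have word: "wd w \<in> FA \<and> P (wd w)" for w
  proof (induction w)
    case Nil
    have "wd [] = fa_one" by (simp add: wd_def fa_one_def)
    then show ?case using assms(2) by simp
  next
    case (Cons g w)
    have "wd (g # w) = fa_mult (fa_gen g) (wd w)"
    proof
      fix v show "wd (g # w) v = fa_mult (fa_gen g) (wd w) v"
        by (cases v) (auto simp: fa_gen_mult_Cons wd_def)
    qed
    then show ?case using Cons assms(3)[of "wd w" g] by simp
  qed
  have "\<forall>x. {w. x w \<noteq> 0} \<subseteq> A \<longrightarrow> x \<in> FA \<and> P x" if "finite A" for A
    using that
  proof (induction A rule: finite_induct)
    case empty
    \<comment> \<open>The rule has no case for zero, so zero is produced as 0 times the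
      unit.\<close>
    have "x = fa_smult 0 fa_one" if "{w. x w \<noteq> 0} \<subseteq> {}" for x :: "'a fa"
      using that by (auto simp: fa_smult_def)
    then show ?case using assms(2,4) FA_one FA_smult by metis
  next
    case (insert w A)
    show ?case
    proof (intro allI impI)
      fix x :: "'a fa" assume x: "{v. x v \<noteq> 0} \<subseteq> insert w A"
      let ?y = "x(w := 0)"
      have "{v. ?y v \<noteq> 0} \<subseteq> A" using x by auto
      then have y: "?y \<in> FA" "P ?y" using insert by blast+
      have eq: "x = fa_add (fa_smult (x w) (wd w)) ?y"
        by (auto simp: fa_add_def fa_smult_def wd_def)
      have "fa_smult (x w) (wd w) \<in> FA" "P (fa_smult (x w) (wd w))" using word[of w] assms(4)[of "wd w"] by auto
      then have "fa_add (fa_smult (x w) (wd w)) ?y \<in> FA" "P (fa_add (fa_smult (x w) (wd w)) ?y)"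
        using y assms(5) by auto
      then show "x \<in> FA \<and> P x" by (simp only: eq[symmetric])
    qed
  qed
  then show ?thesis using assms(1) unfolding FA_def by blast
qed

section \<open>Ideals generated by relations\<close>

lemma ideal_gen_subset: assumes "R \<subseteq> FA" shows "ideal_gen R \<subseteq> FA"
proof
  fix x assume "x \<in> ideal_gen R"
  then show "x \<in> FA" by induction (use assms in auto)
qed

lemma ideal_gen_mult_left:
  assumes "x \<in> ideal_gen R" "a \<in> FA" shows "fa_mult a x \<in> ideal_gen R"
  using assms
proof (induction rule: ideal_gen.induct)
  case (gen r b c)
  have "fa_mult a (fa_mult (fa_mult b r) c) = fa_mult (fa_mult (fa_mult a b) r) c" by (simp add: fa_mult_assoc)
  then show ?case using ideal_gen.gen[OF gen(1), of "fa_mult a b" c] gen by simp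
qed (auto simp: fa_mult_add_right intro: ideal_gen.intros)

lemma ideal_gen_mult_right:
  assumes "x \<in> ideal_gen R" "a \<in> FA" shows "fa_mult x a \<in> ideal_gen R"
  using assms
proof (induction rule: ideal_gen.induct)
  case (gen r b c)
  have "fa_mult (fa_mult (fa_mult b r) c) a = fa_mult (fa_mult b r) (fa_mult c a)" by (simp add: fa_mult_assoc)
  then show ?case using ideal_gen.gen[OF gen(1), of b "fa_mult c a"] gen by simp
qed (auto simp: fa_mult_add_left intro: ideal_gen.intros)

lemma ideal_gen_smult: "x \<in> ideal_gen R \<Longrightarrow> fa_smult a x \<in> ideal_gen R"
  by (simp add: fa_smult_mult ideal_gen_mult_left)

lemma ideal_gen_sub: "x \<in> ideal_gen R \<Longrightarrow> y \<in> ideal_gen R \<Longrightarrow> fa_sub x y \<in> ideal_gen R"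
  by (simp add: fa_sub_alt ideal_gen.add ideal_gen_smult)

lemma ideal_gen_superset: "r \<in> R \<Longrightarrow> r \<in> ideal_gen R"
  using ideal_gen.gen[of r R fa_one fa_one] by simp

lemma sl2_rels_FA: "sl2_rels p s t \<subseteq> FA"
  by (auto simp: sl2_rels_def)

text \<open>A type cannot depend on the parameters \<open>(p, s, t)\<close>, so the reduced enveloping algebras for all
  parameters are packed into one quotient type, as families; \<open>fam_at q\<close> below cuts out the member at
  \<open>q\<close>. The index \<open>p\<close> is kept free because some member has to be nonzero in every characteristic.\<close>

definition fam_ideal :: "nat \<times> 'k \<times> 'k \<Rightarrow> ('k::field) fa set" where
  "fam_ideal q = (case q of (p, s, t) \<Rightarrow> ideal_gen (sl2_rels p s t))"

lemma fam_ideal_zero: "fa_zero \<in> fam_ideal q"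
  and fam_ideal_add: "x \<in> fam_ideal q \<Longrightarrow> y \<in> fam_ideal q \<Longrightarrow> fa_add x y \<in> fam_ideal q"
  and fam_ideal_sub: "x \<in> fam_ideal q \<Longrightarrow> y \<in> fam_ideal q \<Longrightarrow> fa_sub x y \<in> fam_ideal q"
  and fam_ideal_smult: "x \<in> fam_ideal q \<Longrightarrow> fa_smult a x \<in> fam_ideal q"
  and fam_ideal_left: "x \<in> fam_ideal q \<Longrightarrow> b \<in> FA \<Longrightarrow> fa_mult b x \<in> fam_ideal q"
  and fam_ideal_right: "x \<in> fam_ideal q \<Longrightarrow> b \<in> FA \<Longrightarrow> fa_mult x b \<in> fam_ideal q"
  by (cases q; auto simp: fam_ideal_def intro: ideal_gen.intros ideal_gen_sub ideal_gen_smult ideal_gen_mult_left ideal_gen_mult_right)+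

definition fam_rel :: "(nat \<times> 'k \<times> 'k \<Rightarrow> ('k::field) fa) \<Rightarrow> (nat \<times> 'k \<times> 'k \<Rightarrow> 'k fa) \<Rightarrow> bool" where
  "fam_rel x y \<longleftrightarrow> (\<forall>q. x q \<in> FA \<and> y q \<in> FA \<and> fa_sub (x q) (y q) \<in> fam_ideal q)"

lemma fam_rel_refl: "(\<And>q. x q \<in> FA) \<Longrightarrow> fam_rel x x"
  by (simp add: fam_rel_def fam_ideal_zero)

lemma fam_rel_refl_iff: "fam_rel x x \<longleftrightarrow> (\<forall>q. x q \<in> FA)"
  by (auto simp: fam_rel_def fam_ideal_zero)

quotient_type (overloaded) 'k uea = "nat \<times> 'k \<times> 'k \<Rightarrow> ('k::field) fa" / partial: fam_rel
proof (rule part_equivpI)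
  show "\<exists>x::nat \<times> 'k \<times> 'k \<Rightarrow> 'k fa. fam_rel x x" by (rule exI[of _ "\<lambda>_. fa_zero"]) (simp add: fam_rel_refl)
  show "symp (fam_rel :: (nat \<times> 'k \<times> 'k \<Rightarrow> 'k fa) \<Rightarrow> _)"
  proof (rule sympI)
    fix x y :: "nat \<times> 'k \<times> 'k \<Rightarrow> 'k fa" assume a: "fam_rel x y"
    have "fa_sub (y q) (x q) = fa_smult (-1) (fa_sub (x q) (y q))" for q
      by (simp add: fa_sub_def fa_smult_def)
    then show "fam_rel y x" using a fam_ideal_smult unfolding fam_rel_def by metis
  qed
  show "transp (fam_rel :: (nat \<times> 'k \<times> 'k \<Rightarrow> 'k fa) \<Rightarrow> _)"
  proof (rule transpI)
    fix x y z :: "nat \<times> 'k \<times> 'k \<Rightarrow> 'k fa" assume a: "fam_rel x y" "fam_rel y z"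
    have "fa_sub (x q) (z q) = fa_add (fa_sub (x q) (y q)) (fa_sub (y q) (z q))" for q
      by (simp add: fa_sub_def fa_add_def)
    then show "fam_rel x z" using a fam_ideal_add unfolding fam_rel_def by metis
  qed
qed

lemma fam_rel_mult:
  assumes "fam_rel x x'" "fam_rel y y'"
  shows "fam_rel (\<lambda>q. fa_mult (x q) (y q)) (\<lambda>q. fa_mult (x' q) (y' q))"
proof -
  have "fa_sub (fa_mult (x q) (y q)) (fa_mult (x' q) (y' q))
      = fa_add (fa_mult (fa_sub (x q) (x' q)) (y q)) (fa_mult (x' q) (fa_sub (y q) (y' q)))" for q
    unfolding fa_mult_sub_left fa_mult_sub_right by (simp add: fa_add_def fa_sub_def)
  then show ?thesis using assms unfolding fam_rel_def
    by (simp add: fam_ideal_add fam_ideal_left fam_ideal_right)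
qed

lemma fam_rel_add:
  assumes "fam_rel x x'" "fam_rel y y'"
  shows "fam_rel (\<lambda>q. fa_add (x q) (y q)) (\<lambda>q. fa_add (x' q) (y' q))"
proof -
  have "fa_sub (fa_add (x q) (y q)) (fa_add (x' q) (y' q))
      = fa_add (fa_sub (x q) (x' q)) (fa_sub (y q) (y' q))" for q
    by (simp add: fa_add_def fa_sub_def algebra_simps)
  then show ?thesis using assms by (auto simp: fam_rel_def intro: fam_ideal_add)
qed

lemma fam_rel_sub:
  assumes "fam_rel x x'" "fam_rel y y'"
  shows "fam_rel (\<lambda>q. fa_sub (x q) (y q)) (\<lambda>q. fa_sub (x' q) (y' q))"
proof -
  have "fa_sub (fa_sub (x q) (y q)) (fa_sub (x' q) (y' q))
      = fa_sub (fa_sub (x q) (x' q)) (fa_sub (y q) (y' q))" for q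
    by (simp add: fa_sub_def algebra_simps)
  then show ?thesis using assms by (auto simp: fam_rel_def intro: fam_ideal_sub)
qed

text \<open>The member at (1, 0, 0) separates 0 from 1 over every field: its relators have no
  constant term, and taking the constant term is multiplicative. A positive exponent matters, as e^0
  would be the unit.\<close>

lemma augmentation_ideal: "x \<in> ideal_gen (sl2_rels 1 0 0) \<Longrightarrow> x [] = 0"
  by (induction rule: ideal_gen.induct)
    (auto simp: sl2_rels_def fa_zero_def fa_add_def fa_sub_def fa_smult_def fa_gen_def fa_const_def)

instantiation uea :: (field) ring_1
begin

lift_definition zero_uea :: "'a uea" is "\<lambda>_. fa_zero" by (simp add: fam_rel_refl)
lift_definition one_uea :: "'a uea" is "\<lambda>_. fa_one" by (simp add: fam_rel_refl)
lift_definition plus_uea :: "'a uea \<Rightarrow> 'a uea \<Rightarrow> 'a uea" is "\<lambda>x y q. fa_add (x q) (y q)" by (rule fam_rel_add)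
lift_definition minus_uea :: "'a uea \<Rightarrow> 'a uea \<Rightarrow> 'a uea" is "\<lambda>x y q. fa_sub (x q) (y q)" by (rule fam_rel_sub)
lift_definition uminus_uea :: "'a uea \<Rightarrow> 'a uea" is "\<lambda>x q. fa_sub fa_zero (x q)"
  by (rule fam_rel_sub[of "\<lambda>_. fa_zero"]) (simp_all add: fam_rel_refl)
lift_definition times_uea :: "'a uea \<Rightarrow> 'a uea \<Rightarrow> 'a uea" is "\<lambda>x y q. fa_mult (x q) (y q)" by (rule fam_rel_mult)

instance
proof
  show "(0::'a uea) \<noteq> 1"
  proof (transfer, rule notI)
    assume "fam_rel (\<lambda>_. fa_zero :: 'a fa) (\<lambda>_. fa_one)"
    then have "fa_sub fa_zero fa_one \<in> (fam_ideal (1, 0, 0) :: 'a fa set)" by (simp add: fam_rel_def)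
    then show False using augmentation_ideal[of "fa_sub fa_zero fa_one :: 'a fa"]
      by (simp add: fam_ideal_def) (simp add: fa_sub_def fa_zero_def fa_one_def)
  qed
  fix a b c :: "'a uea"
  show "a * b * c = a * (b * c)"
    by transfer (auto simp: fam_rel_refl_iff fa_mult_assoc)
  show "(a + b) * c = a * c + b * c"
    by transfer (auto simp: fam_rel_refl_iff fa_mult_add_left)
  show "a * (b + c) = a * b + a * c"
    by transfer (auto simp: fam_rel_refl_iff fa_mult_add_right)
  show "1 * a = a" by transfer (auto simp: fam_rel_refl_iff)
  show "a * 1 = a" by transfer (auto simp: fam_rel_refl_iff)
  show "0 + a = a" by transfer (auto simp: fam_rel_refl_iff)
  show "a + b + c = a + (b + c)"
  proof transfer
    fix a b c :: "nat \<times> 'a \<times> 'a \<Rightarrow> 'a fa"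
    assume *: "fam_rel a a" "fam_rel b b" "fam_rel c c"
    have "(\<lambda>q. fa_add (fa_add (a q) (b q)) (c q)) = (\<lambda>q. fa_add (a q) (fa_add (b q) (c q)))"
      by (simp add: fa_add_def add.assoc)
    then show "fam_rel (\<lambda>q. fa_add (fa_add (a q) (b q)) (c q)) (\<lambda>q. fa_add (a q) (fa_add (b q) (c q)))"
      using * by (simp add: fam_rel_refl_iff)
  qed
  show "a + b = b + a"
  proof transfer
    fix a b :: "nat \<times> 'a \<times> 'a \<Rightarrow> 'a fa"
    assume *: "fam_rel a a" "fam_rel b b"
    have "(\<lambda>q. fa_add (a q) (b q)) = (\<lambda>q. fa_add (b q) (a q))"
      by (simp add: fa_add_def add.commute)
    then show "fam_rel (\<lambda>q. fa_add (a q) (b q)) (\<lambda>q. fa_add (b q) (a q))"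
      using * by (simp add: fam_rel_refl_iff)
  qed
  show "- a + a = 0"
  proof transfer
    fix a :: "nat \<times> 'a \<times> 'a \<Rightarrow> 'a fa"
    have "(\<lambda>q. fa_add (fa_sub fa_zero (a q)) (a q)) = (\<lambda>_. fa_zero)"
      by (simp add: fa_add_def fa_sub_def fa_zero_def)
    then show "fam_rel (\<lambda>q. fa_add (fa_sub fa_zero (a q)) (a q)) (\<lambda>_. fa_zero)"
      by (simp add: fam_rel_refl_iff)
  qed
  show "a - b = a + - b"
  proof transfer
    fix a b :: "nat \<times> 'a \<times> 'a \<Rightarrow> 'a fa"
    assume *: "fam_rel a a" "fam_rel b b"
    have "(\<lambda>q. fa_sub (a q) (b q)) = (\<lambda>q. fa_add (a q) (fa_sub fa_zero (b q)))"
      by (simp add: fa_add_def fa_sub_def fa_zero_def)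
    then show "fam_rel (\<lambda>q. fa_sub (a q) (b q)) (\<lambda>q. fa_add (a q) (fa_sub fa_zero (b q)))"
      using * by (simp add: fam_rel_refl_iff)
  qed
qed

end

text \<open>The constant family; functions of infinite support go to 0 merely to make the map
  total.\<close>

lift_definition emb :: "('k::field) fa \<Rightarrow> 'k uea" is "\<lambda>x _. if x \<in> FA then x else fa_zero"
  by (simp add: fam_rel_refl)

lift_definition fam_at :: "nat \<times> 'k \<times> 'k \<Rightarrow> ('k::field) uea" is "\<lambda>q q'. if q' = q then fa_one else fa_zero"
  by (simp add: fam_rel_refl)

lemma emb_zero [simp]: "emb fa_zero = 0"
  by transfer (simp add: fam_rel_refl)

lemma emb_one [simp]: "emb fa_one = 1"
  by transfer (simp add: fam_rel_refl)

lemma emb_add: "x \<in> FA \<Longrightarrow> y \<in> FA \<Longrightarrow> emb (fa_add x y) = emb x + emb y"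
  by transfer (simp add: fam_rel_refl)

lemma emb_sub: "x \<in> FA \<Longrightarrow> y \<in> FA \<Longrightarrow> emb (fa_sub x y) = emb x - emb y"
  by transfer (simp add: fam_rel_refl)

lemma emb_mult: "x \<in> FA \<Longrightarrow> y \<in> FA \<Longrightarrow> emb (fa_mult x y) = emb x * emb y"
  by transfer (simp add: fam_rel_refl)

lemma emb_smult: "x \<in> FA \<Longrightarrow> emb (fa_smult a x) = emb (fa_const a) * emb x"
  by (simp add: fa_smult_mult emb_mult)

lemma emb_pow: "x \<in> FA \<Longrightarrow> emb (fa_pow x n) = emb x ^ n"
  by (induction n) (simp_all add: emb_mult)

lemma emb_setsum: "finite A \<Longrightarrow> (\<And>a. a \<in> A \<Longrightarrow> g a \<in> FA) \<Longrightarrow> emb (fa_setsum A g) = (\<Sum>a\<in>A. emb (g a))"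
  by (induction A rule: finite_induct) (simp_all add: fa_setsum_insert emb_add FA_setsum)

lemma emb_const_comm: "emb (fa_const a) * x = x * emb (fa_const a)"
proof transfer
  fix a :: 'a and x :: "nat \<times> 'a \<times> 'a \<Rightarrow> 'a fa" assume "fam_rel x x"
  moreover have "fa_mult (fa_const a) y = fa_mult y (fa_const a)" for y :: "'a fa"
    unfolding fa_const_def fa_mult_smult_left fa_mult_smult_right by simp
  ultimately show "fam_rel (\<lambda>q. fa_mult (if fa_const a \<in> FA then fa_const a else fa_zero) (x q))
      (\<lambda>q. fa_mult (x q) (if fa_const a \<in> FA then fa_const a else fa_zero))"
    by (simp add: fam_rel_refl_iff)
qed

lemma fam_at_comm: "fam_at q * x = x * fam_at q"
proof transfer
  fix q :: "nat \<times> 'a \<times> 'a" and x :: "nat \<times> 'a \<times> 'a \<Rightarrow> 'a fa" assume *: "fam_rel x x"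
  have "(\<lambda>q'. fa_mult (if q' = q then fa_one else fa_zero) (x q'))
      = (\<lambda>q'. fa_mult (x q') (if q' = q then fa_one else fa_zero))" by auto
  with * show "fam_rel (\<lambda>q'. fa_mult (if q' = q then fa_one else fa_zero) (x q'))
      (\<lambda>q'. fa_mult (x q') (if q' = q then fa_one else fa_zero))"
    by (simp add: fam_rel_refl_iff)
qed

lemma fam_at_idem: "fam_at q * fam_at q = fam_at q"
proof transfer
  fix q :: "nat \<times> 'a \<times> 'a"
  have "(\<lambda>q'. fa_mult (if q' = q then fa_one else fa_zero) (if q' = q then fa_one else fa_zero :: 'a fa))
      = (\<lambda>q'. if q' = q then fa_one else fa_zero)" by auto
  then show "fam_rel (\<lambda>q'. fa_mult (if q' = q then fa_one else fa_zero) (if q' = q then fa_one else fa_zero :: 'a fa))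
      (\<lambda>q'. if q' = q then fa_one else fa_zero)"
    by (simp add: fam_rel_refl_iff)
qed

text \<open>The dictionary between the two languages: membership in the ideal of one parameter
  triple is an equation multiplied by the idempotent of that triple.\<close>

lemma fam_at_emb_eq_0_iff: "x \<in> FA \<Longrightarrow> fam_at (p, s, t) * emb x = 0 \<longleftrightarrow> x \<in> ideal_gen (sl2_rels p s t)"
proof transfer
  fix x :: "'a fa" and p :: nat and s t :: 'a assume "x \<in> FA"
  then show "fam_rel (\<lambda>q. fa_mult (if q = (p, s, t) then fa_one else fa_zero) (if x \<in> FA then x else fa_zero)) (\<lambda>_. fa_zero)
      \<longleftrightarrow> x \<in> ideal_gen (sl2_rels p s t)"
    by (auto simp: fam_rel_def fam_ideal_def ideal_gen.zero split: if_splits)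
qed

text \<open>For relators common to all members, so that the sl_2 relations hold in the ring without
  the idempotent.\<close>

lemma emb_eq_0: "x \<in> FA \<Longrightarrow> (\<And>p s t. x \<in> ideal_gen (sl2_rels p s t)) \<Longrightarrow> emb x = 0"
  by transfer (auto simp: fam_rel_def fam_ideal_def)

lemma fam_at_emb_eq_iff:
  "x \<in> FA \<Longrightarrow> y \<in> FA \<Longrightarrow> fam_at (p, s, t) * emb x = fam_at (p, s, t) * emb y \<longleftrightarrow> fa_eq (sl2_rels p s t) x y"
  using fam_at_emb_eq_0_iff[of "fa_sub x y" p s t] by (simp add: emb_sub right_diff_distrib fa_eq_def)

section \<open>Matrix representations\<close>

lemma mult_unit_vec:
  fixes A :: "'a::semiring_1 mat"
  assumes "A \<in> carrier_mat m n" "j < n"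
  shows "A *\<^sub>v unit_vec n j = col A j"
  using assms by (intro eq_vecI) auto

lemma eq_mat_unit_vecI:
  fixes A B :: "'a::semiring_1 mat"
  assumes A: "A \<in> carrier_mat m n" and B: "B \<in> carrier_mat m n"
    and eq: "\<And>j. j < n \<Longrightarrow> A *\<^sub>v unit_vec n j = B *\<^sub>v unit_vec n j"
  shows "A = B"
proof (rule eq_matI)
  fix i j assume ij: "i < dim_row B" "j < dim_col B"
  then have "col A j $ i = col B j $ i" using eq[of j] A B by (simp add: mult_unit_vec[OF A] mult_unit_vec[OF B])
  then show "A $$ (i, j) = B $$ (i, j)" using ij A B by simp
qed (use A B in auto)

lemma zero_mult_mat_vec:
  fixes v :: "'a::semiring_1 vec"
  assumes "v \<in> carrier_vec m" shows "0\<^sub>m n m *\<^sub>v v = 0\<^sub>v n"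
  using assms by (intro eq_vecI) (auto simp: scalar_prod_def)

lemma mult_mat_zero_vec:
  fixes A :: "'a::semiring_1 mat"
  assumes "A \<in> carrier_mat n m" shows "A *\<^sub>v 0\<^sub>v m = 0\<^sub>v n"
  using assms by (intro eq_vecI) (auto simp: scalar_prod_def)

lemma minus_vec_eq_zeroD:
  fixes u v :: "'a::ab_group_add vec"
  assumes "u \<in> carrier_vec n" "v \<in> carrier_vec n" "u - v = 0\<^sub>v n"
  shows "u = v"
proof (rule eq_vecI)
  fix i assume "i < dim_vec v"
  then have i: "i < n" "(u - v) $ i = u $ i - v $ i" using assms(2) by auto
  then show "u $ i = v $ i" unfolding assms(3) by simp
qed (use assms in auto)

lemma fa_act_carrier: "fa_act n \<rho> x \<in> carrier_mat n n"
  by (simp add: fa_act_def)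

lemma fa_act_dim: "dim_row (fa_act n \<rho> x) = n" "dim_col (fa_act n \<rho> x) = n"
  by (simp_all add: fa_act_def)

lemma fa_act_vec_carrier: "fa_act n \<rho> x *\<^sub>v v \<in> carrier_vec n"
  by (rule carrier_vecI) (simp add: fa_act_dim)

context
  fixes n :: nat and \<rho> :: "gen \<Rightarrow> ('k::field) mat"
  assumes \<rho>: "\<And>g. \<rho> g \<in> carrier_mat n n"
begin

lemma word_mat_carrier: "word_mat n \<rho> w \<in> carrier_mat n n"
  by (induction w) (auto intro: \<rho> mult_carrier_mat)

text \<open>Any finite set containing the support may index the sum, which lets two elements be
  summed over a common set.\<close>

lemma fa_act_index:
  assumes "finite A" "{w. x w \<noteq> 0} \<subseteq> A" "i < n" "j < n"
  shows "fa_act n \<rho> x $$ (i, j) = (\<Sum>w\<in>A. x w * word_mat n \<rho> w $$ (i, j))"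
proof -
  have "fa_act n \<rho> x $$ (i, j) = (\<Sum>w\<in>{w. x w \<noteq> 0}. x w * word_mat n \<rho> w $$ (i, j))"
    using assms by (simp add: fa_act_def)
  also have "\<dots> = (\<Sum>w\<in>A. x w * word_mat n \<rho> w $$ (i, j))"
    using assms by (intro sum.mono_neutral_left) auto
  finally show ?thesis .
qed

lemma fa_act_add:
  assumes "x \<in> FA" "y \<in> FA"
  shows "fa_act n \<rho> (fa_add x y) = fa_act n \<rho> x + fa_act n \<rho> y"
proof (rule eq_matI)
  fix i j assume ij: "i < dim_row (fa_act n \<rho> x + fa_act n \<rho> y)" "j < dim_col (fa_act n \<rho> x + fa_act n \<rho> y)"
  let ?A = "{w. x w \<noteq> 0} \<union> {w. y w \<noteq> 0}"
  have A: "finite ?A" using assms by (simp add: FA_def)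
  have sub: "{w. fa_add x y w \<noteq> 0} \<subseteq> ?A" by (auto simp: fa_add_def)
  show "fa_act n \<rho> (fa_add x y) $$ (i, j) = (fa_act n \<rho> x + fa_act n \<rho> y) $$ (i, j)"
    using ij fa_act_index[OF A sub, of i j] fa_act_index[OF A, of x i j] fa_act_index[OF A, of y i j]
    by (simp add: fa_act_dim fa_add_def algebra_simps sum.distrib)
qed (simp_all add: fa_act_dim)

lemma fa_act_smult:
  assumes "x \<in> FA"
  shows "fa_act n \<rho> (fa_smult a x) = a \<cdot>\<^sub>m fa_act n \<rho> x"
proof (rule eq_matI)
  fix i j assume ij: "i < dim_row (a \<cdot>\<^sub>m fa_act n \<rho> x)" "j < dim_col (a \<cdot>\<^sub>m fa_act n \<rho> x)"
  have A: "finite {w. x w \<noteq> 0}" using assms by (simp add: FA_def)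
  have sub: "{w. fa_smult a x w \<noteq> 0} \<subseteq> {w. x w \<noteq> 0}" by (auto simp: fa_smult_def)
  show "fa_act n \<rho> (fa_smult a x) $$ (i, j) = (a \<cdot>\<^sub>m fa_act n \<rho> x) $$ (i, j)"
    using ij fa_act_index[OF A sub, of i j] fa_act_index[OF A, of x i j]
    by (simp add: fa_act_dim fa_smult_def sum_distrib_left mult.assoc)
qed (simp_all add: fa_act_dim)

lemma fa_act_sub:
  assumes "x \<in> FA" "y \<in> FA"
  shows "fa_act n \<rho> (fa_sub x y) = fa_act n \<rho> x - fa_act n \<rho> y"
proof -
  have "fa_act n \<rho> (fa_sub x y) = fa_act n \<rho> x + (-1) \<cdot>\<^sub>m fa_act n \<rho> y"
    using assms by (simp add: fa_sub_alt fa_act_add fa_act_smult)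
  also have "\<dots> = fa_act n \<rho> x - fa_act n \<rho> y" by (rule eq_matI) (simp_all add: fa_act_dim)
  finally show ?thesis .
qed

lemma fa_act_zero: "fa_act n \<rho> fa_zero = 0\<^sub>m n n"
  by (rule eq_matI) (simp_all add: fa_act_def fa_zero_def)

lemma fa_act_one: "fa_act n \<rho> fa_one = 1\<^sub>m n"
proof (rule eq_matI)
  fix i j assume "i < dim_row (1\<^sub>m n :: 'k mat)" "j < dim_col (1\<^sub>m n :: 'k mat)"
  then show "fa_act n \<rho> fa_one $$ (i, j) = 1\<^sub>m n $$ (i, j)"
    using fa_act_index[of "{[]}" fa_one i j] by (simp add: fa_one_def)
qed (simp_all add: fa_act_dim)

lemma fa_act_gen_mult:
  assumes "x \<in> FA"
  shows "fa_act n \<rho> (fa_mult (fa_gen g) x) = \<rho> g * fa_act n \<rho> x"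
proof (rule eq_matI)
  have d: "dim_row (\<rho> g) = n" "dim_col (\<rho> g) = n" using \<rho>[of g] by auto
  fix i j assume "i < dim_row (\<rho> g * fa_act n \<rho> x)" "j < dim_col (\<rho> g * fa_act n \<rho> x)"
  then have ij: "i < n" "j < n" by (simp_all add: fa_act_dim d)
  let ?A = "{w. x w \<noteq> 0}"
  have A: "finite ?A" using assms by (simp add: FA_def)
  have sub: "{w. fa_mult (fa_gen g) x w \<noteq> 0} \<subseteq> (#) g ` ?A"
  proof
    fix w assume "w \<in> {w. fa_mult (fa_gen g) x w \<noteq> 0}"
    then show "w \<in> (#) g ` ?A" by (cases w) (auto simp: fa_gen_mult_Cons split: if_splits)
  qed
  have wd: "dim_row (word_mat n \<rho> w) = n" "dim_col (word_mat n \<rho> w) = n" for w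
    using word_mat_carrier[of w] by auto
  have "fa_act n \<rho> (fa_mult (fa_gen g) x) $$ (i, j)
      = (\<Sum>w\<in>(#) g ` ?A. fa_mult (fa_gen g) x w * word_mat n \<rho> w $$ (i, j))"
    using A by (intro fa_act_index sub ij) simp
  also have "\<dots> = (\<Sum>w\<in>?A. x w * (\<rho> g * word_mat n \<rho> w) $$ (i, j))"
    by (subst sum.reindex) (auto simp: fa_gen_mult_Cons)
  also have "\<dots> = (\<Sum>w\<in>?A. \<Sum>k<n. \<rho> g $$ (i, k) * (x w * word_mat n \<rho> w $$ (k, j)))"
    using ij d wd by (intro sum.cong refl) (simp add: scalar_prod_def sum_distrib_left mult_ac lessThan_atLeast0)
  also have "\<dots> = (\<Sum>k<n. \<rho> g $$ (i, k) * fa_act n \<rho> x $$ (k, j))"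
    using ij A by (subst sum.swap) (simp add: sum_distrib_left fa_act_index[OF A subset_refl])
  also have "\<dots> = (\<rho> g * fa_act n \<rho> x) $$ (i, j)"
    using ij d by (simp add: scalar_prod_def fa_act_dim lessThan_atLeast0)
  finally show "fa_act n \<rho> (fa_mult (fa_gen g) x) $$ (i, j) = (\<rho> g * fa_act n \<rho> x) $$ (i, j)" .
qed (use \<rho>[of g] in \<open>auto simp: fa_act_dim\<close>)

lemma fa_act_gen: "fa_act n \<rho> (fa_gen g) = \<rho> g"
  using fa_act_gen_mult[OF FA_one, of g] \<rho>[of g] by (simp add: fa_act_one)

lemma fa_act_mult:
  assumes "x \<in> FA" "y \<in> FA"
  shows "fa_act n \<rho> (fa_mult x y) = fa_act n \<rho> x * fa_act n \<rho> y"
  using assms(1)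
proof (induction rule: FA_induct)
  case one
  then show ?case using left_mult_one_mat[OF fa_act_carrier[of n \<rho> y]] by (simp add: fa_act_one)
next
  case (gen g x)
  have "fa_act n \<rho> (fa_mult (fa_mult (fa_gen g) x) y) = \<rho> g * (fa_act n \<rho> x * fa_act n \<rho> y)"
    using gen assms by (simp add: fa_mult_assoc fa_act_gen_mult)
  then show ?case using gen assoc_mult_mat[OF \<rho> fa_act_carrier fa_act_carrier] by (simp add: fa_act_gen_mult)
next
  case (smult a x)
  then show ?case using assms mult_smult_assoc_mat[OF fa_act_carrier[of n \<rho> x] fa_act_carrier[of n \<rho> y]]
    by (simp add: fa_mult_smult_left fa_act_smult)
next
  case (add x x')
  then show ?case using assms add_mult_distrib_mat[OF fa_act_carrier[of n \<rho> x] fa_act_carrier[of n \<rho> x'] fa_act_carrier[of n \<rho> y]]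
    by (simp add: fa_mult_add_left fa_act_add)
qed

lemma fa_act_ideal:
  assumes "R \<subseteq> FA" "\<And>r. r \<in> R \<Longrightarrow> fa_act n \<rho> r = 0\<^sub>m n n" "x \<in> ideal_gen R"
  shows "fa_act n \<rho> x = 0\<^sub>m n n"
  using assms(3)
proof induction
  case (gen r a b)
  then have "r \<in> FA" using assms by auto
  then show ?case using gen assms
    by (simp add: fa_act_mult right_mult_zero_mat[OF fa_act_carrier] left_mult_zero_mat[OF fa_act_carrier])
next
  case (add x y)
  then show ?case using ideal_gen_subset[OF assms(1)] fa_act_add[of x y] by auto
qed (rule fa_act_zero)

lemma fa_act_mult_vec:
  assumes "x \<in> FA" "y \<in> FA" "v \<in> carrier_vec n"
  shows "fa_act n \<rho> (fa_mult x y) *\<^sub>v v = fa_act n \<rho> x *\<^sub>v (fa_act n \<rho> y *\<^sub>v v)"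
  using assms by (simp add: fa_act_mult assoc_mult_mat_vec[OF fa_act_carrier fa_act_carrier])

lemma fa_act_sub_vec:
  assumes "x \<in> FA" "y \<in> FA" "v \<in> carrier_vec n"
  shows "fa_act n \<rho> (fa_sub x y) *\<^sub>v v = fa_act n \<rho> x *\<^sub>v v - fa_act n \<rho> y *\<^sub>v v"
  using assms by (simp add: fa_act_sub minus_mult_distrib_mat_vec[OF fa_act_carrier fa_act_carrier])

lemma fa_act_add_vec:
  assumes "x \<in> FA" "y \<in> FA" "v \<in> carrier_vec n"
  shows "fa_act n \<rho> (fa_add x y) *\<^sub>v v = fa_act n \<rho> x *\<^sub>v v + fa_act n \<rho> y *\<^sub>v v"
  using assms by (simp add: fa_act_add add_mult_distrib_mat_vec[OF fa_act_carrier fa_act_carrier])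

lemma fa_act_smult_vec:
  assumes "x \<in> FA" "v \<in> carrier_vec n"
  shows "fa_act n \<rho> (fa_smult a x) *\<^sub>v v = a \<cdot>\<^sub>v (fa_act n \<rho> x *\<^sub>v v)"
  using assms by (intro eq_vecI) (auto simp: fa_act_smult fa_act_dim)

lemma fa_act_const_vec: "v \<in> carrier_vec n \<Longrightarrow> fa_act n \<rho> (fa_const a) *\<^sub>v v = a \<cdot>\<^sub>v v"
  by (simp add: fa_const_def fa_act_smult_vec fa_act_one)

end

text \<open>The kernel of A = C - a is a submodule because C commutes with the generators. If it
  were zero, A would be injective, and A A z = 0 would force z to act as zero; so the kernel is
  everything.\<close>

lemma simple_module_scalar:
  assumes simple: "simple_module R n \<rho>" and R: "R \<subseteq> FA"
    and C: "C \<in> FA" "\<And>g. fa_sub (fa_mult C (fa_gen g)) (fa_mult (fa_gen g) C) \<in> ideal_gen R"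
    and z: "z \<in> FA" "fa_mult (fa_sub C (fa_const a)) (fa_mult (fa_sub C (fa_const a)) z) \<in> ideal_gen R"
      "fa_act n \<rho> z \<noteq> 0\<^sub>m n n"
  shows "fa_act n \<rho> C = a \<cdot>\<^sub>m 1\<^sub>m n"
proof -
  have \<rho>: "\<And>g. \<rho> g \<in> carrier_mat n n" and rel: "\<And>r. r \<in> R \<Longrightarrow> fa_act n \<rho> r = 0\<^sub>m n n"
    and simp': "\<And>W. invariant_subspace n \<rho> W \<Longrightarrow> W = {0\<^sub>v n} \<or> W = carrier_vec n"
    using simple by (auto simp: simple_module_def)
  have ideal: "fa_act n \<rho> x = 0\<^sub>m n n" if "x \<in> ideal_gen R" for x
    by (rule fa_act_ideal[OF \<rho> R _ that]) (rule rel)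
  note car [simp] = fa_act_carrier fa_act_vec_carrier
  define A where "A = fa_act n \<rho> (fa_sub C (fa_const a))"
  have A: "A \<in> carrier_mat n n" by (simp add: A_def)
  have Av: "A *\<^sub>v v = fa_act n \<rho> C *\<^sub>v v - a \<cdot>\<^sub>v v" if "v \<in> carrier_vec n" for v
    using that C by (simp add: A_def fa_act_sub_vec[OF \<rho>] fa_act_const_vec[OF \<rho>])
  have comm: "fa_act n \<rho> C *\<^sub>v (\<rho> g *\<^sub>v v) = \<rho> g *\<^sub>v (fa_act n \<rho> C *\<^sub>v v)" if v: "v \<in> carrier_vec n" for g v
  proof -
    have "fa_act n \<rho> (fa_sub (fa_mult C (fa_gen g)) (fa_mult (fa_gen g) C)) *\<^sub>v v = 0\<^sub>v n"
      using v by (simp add: ideal[OF C(2)] zero_mult_mat_vec)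
    then have eq: "fa_act n \<rho> C *\<^sub>v (\<rho> g *\<^sub>v v) - \<rho> g *\<^sub>v (fa_act n \<rho> C *\<^sub>v v) = 0\<^sub>v n"
      using v C(1) by (simp add: fa_act_sub_vec[OF \<rho>] fa_act_mult_vec[OF \<rho>] fa_act_gen[OF \<rho>])
    show ?thesis
      by (rule minus_vec_eq_zeroD[OF fa_act_vec_carrier mult_mat_vec_carrier[OF \<rho> fa_act_vec_carrier] eq])
  qed
  define K where "K = {v \<in> carrier_vec n. A *\<^sub>v v = 0\<^sub>v n}"
  have "invariant_subspace n \<rho> K"
    unfolding invariant_subspace_def
  proof (intro conjI ballI allI)
    show "K \<subseteq> carrier_vec n" by (auto simp: K_def)
    show "0\<^sub>v n \<in> K" by (simp add: K_def mult_mat_zero_vec[OF A])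
    show "v + u \<in> K" if "v \<in> K" "u \<in> K" for v u
      using that by (simp add: K_def mult_add_distrib_mat_vec[OF A])
    show "b \<cdot>\<^sub>v v \<in> K" if "v \<in> K" for b v
      using that by (simp add: K_def mult_mat_vec[OF A]) (auto intro!: eq_vecI)
    show "\<rho> g *\<^sub>v v \<in> K" if "v \<in> K" for g v
    proof -
      have v: "v \<in> carrier_vec n" "A *\<^sub>v v = 0\<^sub>v n" using that by (simp_all add: K_def)
      have gv: "\<rho> g *\<^sub>v v \<in> carrier_vec n" by (rule mult_mat_vec_carrier[OF \<rho> v(1)])
      have "A *\<^sub>v (\<rho> g *\<^sub>v v) = \<rho> g *\<^sub>v (fa_act n \<rho> C *\<^sub>v v) - a \<cdot>\<^sub>v (\<rho> g *\<^sub>v v)"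
        by (simp only: Av[OF gv] comm[OF v(1)])
      also have "\<dots> = \<rho> g *\<^sub>v (fa_act n \<rho> C *\<^sub>v v - a \<cdot>\<^sub>v v)"
        using v by (simp add: mult_minus_distrib_mat_vec[OF \<rho>] mult_mat_vec[OF \<rho>])
      also have "\<dots> = 0\<^sub>v n" unfolding Av[OF v(1), symmetric] v(2) by (rule mult_mat_zero_vec[OF \<rho>])
      finally show ?thesis using gv by (simp add: K_def)
    qed
  qed
  then have "K = {0\<^sub>v n} \<or> K = carrier_vec n" by (rule simp')
  moreover have "K \<noteq> {0\<^sub>v n}"
  proof
    assume K: "K = {0\<^sub>v n}"
    have inj: "v = 0\<^sub>v n" if "v \<in> carrier_vec n" "A *\<^sub>v v = 0\<^sub>v n" for v
      using that K by (auto simp: K_def)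
    have "fa_act n \<rho> z *\<^sub>v v = 0\<^sub>v n" if v: "v \<in> carrier_vec n" for v
    proof -
      have "fa_act n \<rho> (fa_mult (fa_sub C (fa_const a)) (fa_mult (fa_sub C (fa_const a)) z)) *\<^sub>v v = 0\<^sub>v n"
        using v by (simp add: ideal[OF z(2)] zero_mult_mat_vec)
      then have "A *\<^sub>v (A *\<^sub>v (fa_act n \<rho> z *\<^sub>v v)) = 0\<^sub>v n"
        using v z(1) C(1) by (simp add: A_def fa_act_mult_vec[OF \<rho>])
      then have "A *\<^sub>v (fa_act n \<rho> z *\<^sub>v v) = 0\<^sub>v n" by (rule inj[rotated]) (simp add: A_def)
      then show ?thesis by (rule inj[rotated]) simp
    qed
    then have "fa_act n \<rho> z = 0\<^sub>m n n"
      by (intro eq_mat_unit_vecI[of _ n n]) (auto simp: zero_mult_mat_vec)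
    then show False using z(3) by simp
  qed
  ultimately have K: "A *\<^sub>v v = 0\<^sub>v n" if "v \<in> carrier_vec n" for v
    using that by (auto simp: K_def)
  have "A = 0\<^sub>m n n" by (rule eq_mat_unit_vecI[OF A]) (auto simp: K zero_mult_mat_vec)
  then have "fa_act n \<rho> C - a \<cdot>\<^sub>m 1\<^sub>m n = 0\<^sub>m n n"
    using C(1) by (simp add: A_def fa_act_sub[OF \<rho>] fa_const_def fa_act_smult[OF \<rho>] fa_act_one[OF \<rho>])
  then have eq: "(fa_act n \<rho> C - a \<cdot>\<^sub>m 1\<^sub>m n) $$ (i, j) = 0\<^sub>m n n $$ (i, j)" for i j
    by (rule arg_cong)
  show ?thesis
  proof (rule eq_matI)
    fix i j assume "i < dim_row (a \<cdot>\<^sub>m 1\<^sub>m n)" "j < dim_col (a \<cdot>\<^sub>m 1\<^sub>m n)"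
    then show "fa_act n \<rho> C $$ (i, j) = (a \<cdot>\<^sub>m 1\<^sub>m n) $$ (i, j)"
      using eq[of i j] by (simp add: fa_act_dim)
  qed (simp_all add: fa_act_dim)
qed

text \<open>The baby Verma module in the basis of classes of f^j, j < p: e f^j becomes j (l - j + 1)
  f^(j-1), and f sends the last vector to t times the first.\<close>

fun verma :: "nat \<Rightarrow> 'k::field \<Rightarrow> 'k \<Rightarrow> gen \<Rightarrow> 'k mat" where
  "verma p l t Ge = mat p p (\<lambda>(i, j). if j = Suc i then of_nat j * (l - of_nat j + 1) else 0)"
| "verma p l t Gf = mat p p (\<lambda>(i, j). if i = Suc j then 1 else if i = 0 \<and> Suc j = p then t else 0)"
| "verma p l t Gh = mat p p (\<lambda>(i, j). if i = j then l - of_nat (2 * j) else 0)"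

context
  fixes p :: nat and l s t :: "'k::field"
  assumes p: "2 < p" "CHAR('k) = p" and l: "l ^ p - l = s" and prime: "prime p"
begin

private abbreviation (input) "V \<equiv> verma p l t"
private abbreviation (input) "av \<equiv> \<lambda>x. fa_act p V x"
private abbreviation (input) "w \<equiv> (unit_vec p :: nat \<Rightarrow> 'k vec)"

private definition cf :: "nat \<Rightarrow> 'k" where "cf j = of_nat j * (l - of_nat j + 1)"

lemma V_carrier: "V g \<in> carrier_mat p p"
  by (cases g) auto

lemma of_nat_p: "of_nat p = (0::'k)"
  using p(2) by auto

lemma V_f: "Suc j < p \<Longrightarrow> V Gf *\<^sub>v w j = w (Suc j)"
  by (subst mult_unit_vec[OF V_carrier]) (auto intro!: eq_vecI simp: unit_vec_def)

lemma V_f_last: "Suc j = p \<Longrightarrow> V Gf *\<^sub>v w j = t \<cdot>\<^sub>v w 0"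
  by (subst mult_unit_vec[OF V_carrier]) (auto intro!: eq_vecI simp: unit_vec_def)

text \<open>At j = 0 the truncated index j - 1 is harmless, since the coefficient is 0.\<close>

lemma V_e: "j < p \<Longrightarrow> V Ge *\<^sub>v w j = cf j \<cdot>\<^sub>v w (j - 1)"
  by (subst mult_unit_vec[OF V_carrier]) (cases j; auto intro!: eq_vecI simp: unit_vec_def cf_def)+

lemma V_h: "j < p \<Longrightarrow> V Gh *\<^sub>v w j = (l - of_nat (2 * j)) \<cdot>\<^sub>v w j"
  by (subst mult_unit_vec[OF V_carrier]) (auto intro!: eq_vecI simp: unit_vec_def)

declare verma.simps [simp del]

lemma zero_smult_w: "0 \<cdot>\<^sub>v w j = 0\<^sub>v p"
  by (rule eq_vecI) auto

lemma V_smult: "V g *\<^sub>v (a \<cdot>\<^sub>v w j) = a \<cdot>\<^sub>v (V g *\<^sub>v w j)"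
  by (rule mult_mat_vec[OF V_carrier]) simp

lemma V_ef: assumes "j < p" shows "V Ge *\<^sub>v (V Gf *\<^sub>v w j) = cf (Suc j) \<cdot>\<^sub>v w j"
proof (cases "Suc j = p")
  case True
  \<comment> \<open>At the wrap-around, e kills t times the first vector; this agrees with the
    general formula because p = 0 in k.\<close>
  then have "cf (Suc j) = 0" using of_nat_p by (simp add: cf_def del: of_nat_Suc)
  moreover have "cf 0 = 0" by (simp add: cf_def)
  moreover have "t \<cdot>\<^sub>v 0\<^sub>v p = 0\<^sub>v p" by (rule eq_vecI) auto
  ultimately show ?thesis using True p V_e[of 0] by (simp add: V_f_last V_smult zero_smult_w)
qed (use V_e[of "Suc j"] assms in \<open>simp add: V_f\<close>)

lemma V_fe: assumes "j < p" shows "V Gf *\<^sub>v (V Ge *\<^sub>v w j) = cf j \<cdot>\<^sub>v w j"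
proof (cases j)
  case 0
  then have "cf j = 0" by (simp add: cf_def)
  then show ?thesis using assms by (simp add: V_e zero_smult_w mult_mat_zero_vec[OF V_carrier])
qed (use assms in \<open>simp add: V_e V_smult V_f\<close>)

lemma av_mult: "x \<in> FA \<Longrightarrow> y \<in> FA \<Longrightarrow> av (fa_mult x y) *\<^sub>v w j = av x *\<^sub>v (av y *\<^sub>v w j)"
  by (rule fa_act_mult_vec[OF V_carrier]) simp_all

lemma av_gen: "av (fa_gen g) = V g"
  by (rule fa_act_gen[OF V_carrier])

lemma av_pow_Suc: "av (fa_pow (fa_gen g) (Suc k)) *\<^sub>v w j = V g *\<^sub>v (av (fa_pow (fa_gen g) k) *\<^sub>v w j)"
  by (simp add: av_mult av_gen)

lemma av_one: "av fa_one *\<^sub>v w j = w j"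
  by (simp add: fa_act_one[OF V_carrier])

lemma av_e_pow: "j < p \<Longrightarrow> \<exists>a. av (fa_pow E k) *\<^sub>v w j = a \<cdot>\<^sub>v w (j - k) \<and> (j < k \<longrightarrow> a = 0)"
proof (induction k)
  case 0
  then show ?case by (intro exI[of _ 1]) (simp add: av_one)
next
  case (Suc k)
  then obtain a where a: "av (fa_pow E k) *\<^sub>v w j = a \<cdot>\<^sub>v w (j - k)" "j < k \<longrightarrow> a = 0" by auto
  have "j - k = 0 \<Longrightarrow> cf (j - k) = 0" by (simp add: cf_def)
  then show ?case using a Suc.prems unfolding av_pow_Suc
    by (intro exI[of _ "a * cf (j - k)"]) (auto simp: V_smult V_e smult_smult_assoc)
qed

text \<open>The bound k \<le> p allows at most one wrap-around, hence at most one factor t.\<close>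

lemma av_f_pow:
  "j < p \<Longrightarrow> k \<le> p \<Longrightarrow> av (fa_pow F k) *\<^sub>v w j = (if j + k < p then w (j + k) else t \<cdot>\<^sub>v w (j + k - p))"
proof (induction k)
  case 0
  then show ?case by (simp add: av_one)
next
  case (Suc k)
  then have IH: "av (fa_pow F k) *\<^sub>v w j = (if j + k < p then w (j + k) else t \<cdot>\<^sub>v w (j + k - p))" by simp
  consider "j + Suc k < p" | "Suc (j + k) = p" | "p \<le> j + k" by linarith
  then show ?case
  proof cases
    case 3
    then have "Suc (j + k - p) < p" "Suc (j + k - p) = j + Suc k - p" using Suc.prems by auto
    then show ?thesis using 3 unfolding av_pow_Suc IH by (simp add: V_smult V_f)
  qed (auto simp: av_pow_Suc IH V_f V_f_last simp del: fa_pow.simps)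
qed

lemma av_h_pow: "j < p \<Longrightarrow> av (fa_pow H k) *\<^sub>v w j = (l - of_nat (2 * j)) ^ k \<cdot>\<^sub>v w j"
proof (induction k)
  case 0
  then show ?case by (simp add: av_one)
next
  case (Suc k)
  then show ?case unfolding av_pow_Suc by (simp add: V_smult V_h smult_smult_assoc mult.commute)
qed

lemma verma_rels:
  assumes "r \<in> sl2_rels p s t"
  shows "av r = 0\<^sub>m p p"
proof (rule eq_mat_unit_vecI[OF fa_act_carrier])
  fix j assume j: "j < p"
  note [simp] = V_carrier fa_act_sub_vec[OF V_carrier] fa_act_add_vec[OF V_carrier] fa_act_smult_vec[OF V_carrier]
    av_mult av_gen fa_act_const_vec[OF V_carrier]
  have "av r *\<^sub>v w j = 0\<^sub>v p"
    using assms unfolding sl2_rels_def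
  proof (elim insertE)
    assume "r = fa_sub (fa_sub (fa_mult E F) (fa_mult F E)) H"
    then have "av r *\<^sub>v w j = cf (Suc j) \<cdot>\<^sub>v w j - cf j \<cdot>\<^sub>v w j - (l - of_nat (2 * j)) \<cdot>\<^sub>v w j"
      using j by (simp add: V_ef V_fe V_h)
    also have "\<dots> = (cf (Suc j) - cf j - (l - of_nat (2 * j))) \<cdot>\<^sub>v w j"
      by (rule eq_vecI) (auto simp: algebra_simps)
    also have "cf (Suc j) - cf j - (l - of_nat (2 * j)) = 0" by (simp add: cf_def algebra_simps)
    finally show ?thesis by (simp add: zero_smult_w)
  next
    assume "r = fa_sub (fa_sub (fa_mult H E) (fa_mult E H)) (fa_smult 2 E)"
    then have "av r *\<^sub>v w j = cf j \<cdot>\<^sub>v ((l - of_nat (2 * (j - 1))) \<cdot>\<^sub>v w (j - 1)) - (l - of_nat (2 * j)) \<cdot>\<^sub>v (cf j \<cdot>\<^sub>v w (j - 1)) - 2 \<cdot>\<^sub>v (cf j \<cdot>\<^sub>v w (j - 1))"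
      using j by (simp add: V_e V_h V_smult)
    also have "\<dots> = (cf j * (l - of_nat (2 * (j - 1)) - (l - of_nat (2 * j)) - 2)) \<cdot>\<^sub>v w (j - 1)"
      by (rule eq_vecI) (auto simp: algebra_simps)
    also have "cf j * (l - of_nat (2 * (j - 1)) - (l - of_nat (2 * j)) - 2) = 0"
      by (cases j) (simp_all add: cf_def)
    finally show ?thesis by (simp add: zero_smult_w)
  next
    assume r: "r = fa_add (fa_sub (fa_mult H F) (fa_mult F H)) (fa_smult 2 F)"
    show ?thesis
    proof (cases "Suc j = p")
      case True
      \<comment> \<open>The last index is p - 1 = -1 in k, so the weights l + 2 and l of the last
        and first vectors differ by 2 as [h, f] = -2 f demands.\<close>
      then have jp: "of_nat j = (-1::'k)" using of_nat_p by (metis add.commute eq_neg_iff_add_eq_0 of_nat_Suc)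
      have "av r *\<^sub>v w j = t \<cdot>\<^sub>v ((l - of_nat (2 * 0)) \<cdot>\<^sub>v w 0) - (l - of_nat (2 * j)) \<cdot>\<^sub>v (t \<cdot>\<^sub>v w 0) + 2 \<cdot>\<^sub>v (t \<cdot>\<^sub>v w 0)"
        using j True p V_h[of 0] by (simp add: r V_f_last V_h V_smult)
      also have "\<dots> = 0\<^sub>v p" by (rule eq_vecI) (auto simp: jp algebra_simps)
      finally show ?thesis .
    next
      case False
      then have "av r *\<^sub>v w j = (l - of_nat (2 * Suc j)) \<cdot>\<^sub>v w (Suc j) - (l - of_nat (2 * j)) \<cdot>\<^sub>v w (Suc j) + 2 \<cdot>\<^sub>v w (Suc j)"
        using j by (simp add: r V_f V_h V_smult)
      also have "\<dots> = 0\<^sub>v p" by (rule eq_vecI) (auto simp: algebra_simps)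
      finally show ?thesis .
    qed
  next
    assume "r = fa_pow E p"
    then show ?thesis using av_e_pow[OF j, of p] j zero_smult_w by auto
  next
    assume "r = fa_sub (fa_pow F p) (fa_const t)"
    then show ?thesis using av_f_pow[OF j, of p] j by simp
  next
    assume "r = fa_sub (fa_sub (fa_pow H p) H) (fa_const s)"
    then have "av r *\<^sub>v w j = (l - of_nat (2 * j)) ^ p \<cdot>\<^sub>v w j - (l - of_nat (2 * j)) \<cdot>\<^sub>v w j - s \<cdot>\<^sub>v w j"
      using j by (simp add: av_h_pow V_h)
    also have "\<dots> = ((l - of_nat (2 * j)) ^ p - (l - of_nat (2 * j)) - s) \<cdot>\<^sub>v w j"
      by (rule eq_vecI) (auto simp: algebra_simps)
    also have "(l - of_nat (2 * j)) ^ p - (l - of_nat (2 * j)) - s = 0"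
      using artin_schreier_shift[of l "2 * j"] prime p(2) l by simp
    finally show ?thesis by (simp add: zero_smult_w)
  qed simp
  then show "av r *\<^sub>v w j = 0\<^sub>m p p *\<^sub>v w j" by (simp add: zero_mult_mat_vec)
qed simp

text \<open>Apply the element to the first basis vector: e and h - l kill it, while f^m sends it to
  a basis vector.\<close>

lemma verma_f_pow_notin:
  assumes "a \<in> FA" "b \<in> FA" "m < p"
  shows "fa_sub (fa_pow F m) (fa_add (fa_mult a E) (fa_mult b (fa_sub H (fa_const l)))) \<notin> ideal_gen (sl2_rels p s t)"
proof
  let ?x = "fa_sub (fa_pow F m) (fa_add (fa_mult a E) (fa_mult b (fa_sub H (fa_const l))))"
  assume x: "?x \<in> ideal_gen (sl2_rels p s t)"
  have "av ?x = 0\<^sub>m p p"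
    by (rule fa_act_ideal[OF V_carrier sl2_rels_FA _ x]) (rule verma_rels)
  then have z: "av ?x *\<^sub>v w 0 = 0\<^sub>v p" by (simp add: zero_mult_mat_vec)
  have p0: "0 < p" using p by simp
  have e: "V Ge *\<^sub>v w 0 = 0\<^sub>v p" using V_e[OF p0] by (simp add: cf_def zero_smult_w)
  have h: "av (fa_sub H (fa_const l)) *\<^sub>v w 0 = 0\<^sub>v p"
    using V_h[OF p0] by (simp add: fa_act_sub_vec[OF V_carrier] fa_act_const_vec[OF V_carrier] av_gen)
  have "av x *\<^sub>v 0\<^sub>v p = 0\<^sub>v p" for x
    by (rule mult_mat_zero_vec[OF fa_act_carrier])
  then have "av ?x *\<^sub>v w 0 = w m - (0\<^sub>v p + 0\<^sub>v p)"
    using assms av_f_pow[OF p0, of m] e h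
    by (simp add: fa_act_sub_vec[OF V_carrier] fa_act_add_vec[OF V_carrier] av_mult av_gen)
  then have "w m = 0\<^sub>v p" using z by simp
  then show False using unit_vec_nonzero[OF assms(3)] by blast
qed

end

section \<open>Blocks\<close>

lemma fa_const_add: "fa_const (a + b) = fa_add (fa_const a) (fa_const b)"
  by (simp add: fa_const_def fa_smult_def fa_add_def fa_one_def fun_eq_iff)

lemma fa_const_mult: "fa_const (a * b) = fa_mult (fa_const a) (fa_const b)"
  unfolding fa_const_def fa_mult_smult_left by (simp add: fa_smult_def mult.assoc)

lemma fa_const_one: "fa_const 1 = fa_one"
  by (simp add: fa_const_def fa_smult_def)

lemma emb_rels:
  shows "emb E * emb F - emb F * emb E = (emb H :: 'a::field uea)"
    and "emb H * emb E - emb E * emb H = 2 * (emb E :: 'a uea)"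
    and "emb H * emb F - emb F * emb H = - (2 * (emb F :: 'a uea))"
proof -
  have two: "emb (fa_const 2) = (2 :: 'a uea)"
    using fa_const_add[of 1 "1::'a"] by (simp add: emb_add fa_const_one)
  have "emb (fa_sub (fa_sub (fa_mult E F) (fa_mult F E)) H) = (0 :: 'a uea)"
    by (rule emb_eq_0) (auto intro!: ideal_gen_superset simp: sl2_rels_def)
  then show "emb E * emb F - emb F * emb E = (emb H :: 'a uea)" by (simp add: emb_sub emb_mult)
  have "emb (fa_sub (fa_sub (fa_mult H E) (fa_mult E H)) (fa_smult 2 E)) = (0 :: 'a uea)"
    by (rule emb_eq_0) (auto intro!: ideal_gen_superset simp: sl2_rels_def)
  then show "emb H * emb E - emb E * emb H = 2 * (emb E :: 'a uea)"
    by (simp add: emb_sub emb_mult emb_smult two)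
  have "emb (fa_add (fa_sub (fa_mult H F) (fa_mult F H)) (fa_smult 2 F)) = (0 :: 'a uea)"
    by (rule emb_eq_0) (auto intro!: ideal_gen_superset simp: sl2_rels_def)
  then show "emb H * emb F - emb F * emb H = - (2 * (emb F :: 'a uea))"
    by (simp add: emb_add emb_sub emb_mult emb_smult two eq_neg_iff_add_eq_0)
qed

context
  fixes p :: nat and s t :: "'k::field"
  assumes p: "prime p" "2 < p" "CHAR('k) = p" and closed: "alg_closed TYPE('k)"
begin

private abbreviation (input) "R \<equiv> sl2_rels p s t"
private abbreviation (input) "D \<equiv> fam_at (p, s, t)"
private abbreviation (input) "scal \<equiv> \<lambda>a::'k. emb (fa_const a)"

lemma uea_sl2_alg: "sl2_alg (emb E) (emb F) (emb H) D scal p s t"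
proof
  note rel = fam_at_emb_eq_0_iff[of _ p s t, THEN iffD2, OF _ ideal_gen_superset]
  show "D * emb E ^ p = 0"
    using rel[of "fa_pow E p"] by (simp add: sl2_rels_def emb_pow)
  show "D * emb F ^ p = D * scal t"
    using rel[of "fa_sub (fa_pow F p) (fa_const t)"]
    by (simp add: sl2_rels_def emb_pow emb_sub right_diff_distrib)
  show "D * (emb H ^ p - emb H) = D * scal s"
    using rel[of "fa_sub (fa_sub (fa_pow H p) H) (fa_const s)"]
    by (simp add: sl2_rels_def emb_pow emb_sub right_diff_distrib)
  show "\<exists>y. y ^ p - y = s" by (rule artin_schreier_root[OF p closed])
qed (use p in \<open>simp_all add: emb_rels fa_const_add fa_const_mult fa_const_one emb_add emb_mult
    emb_const_comm[of _ "emb (fa_const _)"] fam_at_idem\<close>, (rule emb_const_comm fam_at_comm)+)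

interpretation U: sl2_alg "emb E" "emb F" "emb H" D scal p s t
  by (rule uea_sl2_alg)

lemma emb_casimir: "emb casimir = U.c"
proof -
  have "fa_pow x 2 = fa_mult x x" for x :: "'k fa" by (simp add: numeral_2_eq_2)
  then show ?thesis
    by (simp add: casimir_def U.c_def emb_add emb_mult emb_sub emb_smult U.sc_numeral power2_eq_square)
qed

lemma emb_of_poly: "emb (fa_of_poly q) = pev scal U.c q"
  unfolding fa_of_poly_def by (simp add: emb_setsum emb_smult emb_pow emb_casimir pev_def)

lemma emb_in_G: "x \<in> FA \<Longrightarrow> emb x \<in> U.G"
proof (induction rule: FA_induct)
  case (gen g x)
  then show ?case by (cases g) (simp_all add: emb_mult U.G_e U.G_f U.G_h)
qed (simp_all add: emb_add emb_smult U.G_one U.G_add U.G_sc)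

lemma G_imp_emb: "y \<in> U.G \<Longrightarrow> \<exists>x\<in>FA. y = emb x"
proof (induction rule: U.G.induct)
  case G_one
  then show ?case by (intro bexI[of _ fa_one]) simp_all
next
  case (G_e x)
  then obtain z where "z \<in> FA" "x = emb z" by blast
  then show ?case by (intro bexI[of _ "fa_mult E z"]) (simp_all add: emb_mult)
next
  case (G_f x)
  then obtain z where "z \<in> FA" "x = emb z" by blast
  then show ?case by (intro bexI[of _ "fa_mult F z"]) (simp_all add: emb_mult)
next
  case (G_h x)
  then obtain z where "z \<in> FA" "x = emb z" by blast
  then show ?case by (intro bexI[of _ "fa_mult H z"]) (simp_all add: emb_mult)
next
  case (G_sc x a)
  then obtain z where "z \<in> FA" "x = emb z" by blast
  then show ?case by (intro bexI[of _ "fa_smult a z"]) (simp_all add: emb_smult)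
next
  case (G_add x y)
  then obtain z z' where "z \<in> FA" "x = emb z" "z' \<in> FA" "y = emb z'" by blast
  then show ?case by (intro bexI[of _ "fa_add z z'"]) (simp_all add: emb_add)
qed

lemma uea_sl2_alg_faithful: "sl2_alg_faithful (emb E) (emb F) (emb H) D scal p s t"
proof
  fix l m assume lm: "l ^ p - l = s" "m < p"
  show "emb F ^ m \<notin> U.L l"
  proof
    assume "emb F ^ m \<in> U.L l"
    then obtain a b where ab: "a \<in> FA" "b \<in> FA"
      and eq: "D * emb F ^ m = D * (emb a * emb E + emb b * (emb H - scal l))"
      unfolding U.L_def using G_imp_emb by blast
    let ?x = "fa_sub (fa_pow F m) (fa_add (fa_mult a E) (fa_mult b (fa_sub H (fa_const l))))"
    have "?x \<in> FA" using ab by simp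
    moreover have "D * emb ?x = 0"
      using ab eq by (simp add: emb_sub emb_add emb_mult emb_pow right_diff_distrib)
    ultimately show False
      using verma_f_pow_notin[OF p(2,3) lm(1) p(1) ab lm(2)] fam_at_emb_eq_0_iff[of ?x p s t] by blast
  qed
qed

interpretation U: sl2_alg_faithful "emb E" "emb F" "emb H" D scal p s t
  by (rule uea_sl2_alg_faithful)

section \<open>Central idempotents and indecomposability of the blocks\<close>

context
  fixes S :: "'k set" and n :: "'k \<Rightarrow> nat" and \<pi> :: "'k \<Rightarrow> 'k poly"
  assumes crt: "crt_system S n \<pi> (Phi p - [:s\<^sup>2:])"
    and weight: "\<And>a. a \<in> S \<Longrightarrow> \<exists>l. (l + 1)\<^sup>2 = a \<and> l ^ p - l = s"
begin

interpretation crt_system S n \<pi> "Phi p - [:s\<^sup>2:]"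
  by (rule crt)

lemma idempotent_not_in_ideal:
  assumes "a \<in> S" shows "fa_of_poly (\<pi> a) \<notin> ideal_gen R"
proof -
  obtain l where "(l + 1)\<^sup>2 = a" "l ^ p - l = s" using weight[OF assms] by blast
  then have "D * emb (fa_of_poly (\<pi> a)) \<noteq> 0"
    unfolding emb_of_poly using U.pev_c_nonzero eval_one[OF assms] by simp
  then show ?thesis using fam_at_emb_eq_0_iff[of "fa_of_poly (\<pi> a)" p s t] FA_of_poly by blast
qed

text \<open>With b = (l + 1)^2, the idempotent fixes v, so its polynomial has value 1 at b; it is
  annihilated by (c - a)^2, so (b - a)^2 = 0.\<close>

lemma hw_in_block_weight:
  assumes a: "a \<in> S" and v: "U.hw l v" "v \<noteq> 0" "pev scal U.c (\<pi> a) * v = v"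
  shows "(l + 1)\<^sup>2 = a"
proof -
  let ?b = "(l + 1)\<^sup>2"
  have "scal (poly (\<pi> a) ?b) * v = v" using U.pev_c_hw[OF v(1)] v(3) by simp
  then have "scal (poly (\<pi> a) ?b - 1) * v = 0" by (simp add: U.sc_diff U.sc_one left_diff_distrib)
  then have 1: "poly (\<pi> a) ?b = 1" using U.sc_cancel v(2) by (metis right_minus_eq)
  have "D * pev scal U.c ([:-a, 1:] ^ 2 * \<pi> a) = 0" by (rule U.pev_c_zero_mod[OF square_annihilates[OF a]])
  then have "pev scal U.c ([:-a, 1:] ^ 2 * \<pi> a) * (D * v) = 0"
    using U.d_left_commute[of "pev scal U.c ([:-a, 1:] ^ 2 * \<pi> a)" v] by (simp flip: mult.assoc)
  then have "scal (poly ([:-a, 1:] ^ 2 * \<pi> a) ?b) * v = 0"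
    using U.pev_c_hw[OF v(1)] v(1) by (simp add: U.hw_def)
  then have "poly ([:-a, 1:] ^ 2 * \<pi> a) ?b = 0" using U.sc_cancel v(2) by metis
  then show ?thesis using 1 by (simp add: poly_power)
qed

lemma block_indecomposable:
  assumes a: "a \<in> S"
    and J: "fa_ideal J1" "fa_ideal J2" "ideal_gen R \<subseteq> J1" "ideal_gen R \<subseteq> J2" "J1 \<inter> J2 = ideal_gen R"
      "{fa_add x y | x y. x \<in> J1 \<and> y \<in> J2} = principal_ideal R (fa_of_poly (\<pi> a))"
  shows "J1 = ideal_gen R \<or> J2 = ideal_gen R"
proof (rule ccontr)
  assume "\<not> (J1 = ideal_gen R \<or> J2 = ideal_gen R)"
  then obtain w1 w2 where w1: "w1 \<in> J1" "w1 \<notin> ideal_gen R" and w2: "w2 \<in> J2" "w2 \<notin> ideal_gen R"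
    using J by blast
  let ?z = "fa_of_poly (\<pi> a)"
  let ?Z = "pev scal U.c (\<pi> a)"
  note Z = emb_of_poly[of "\<pi> a"]
  have FA: "J1 \<subseteq> FA" "J2 \<subseteq> FA" and zero: "fa_zero \<in> J1" "fa_zero \<in> J2"
    and add: "\<And>x y. x \<in> J1 \<Longrightarrow> y \<in> J1 \<Longrightarrow> fa_add x y \<in> J1" "\<And>x y. x \<in> J2 \<Longrightarrow> y \<in> J2 \<Longrightarrow> fa_add x y \<in> J2"
    and mult: "\<And>x b. x \<in> J1 \<Longrightarrow> b \<in> FA \<Longrightarrow> fa_mult b x \<in> J1 \<and> fa_mult x b \<in> J1"
      "\<And>x b. x \<in> J2 \<Longrightarrow> b \<in> FA \<Longrightarrow> fa_mult b x \<in> J2 \<and> fa_mult x b \<in> J2"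
    using J(1,2) unfolding fa_ideal_def by auto
  have sub: "x \<in> J1 \<Longrightarrow> y \<in> J1 \<Longrightarrow> fa_sub x y \<in> J1" "x \<in> J2 \<Longrightarrow> y \<in> J2 \<Longrightarrow> fa_sub x y \<in> J2" for x y
    using add mult by (simp_all add: fa_sub_alt fa_smult_mult)
  have van: "D * emb x = 0" if "x \<in> J1" "x \<in> J2" for x
    using that FA J(5) fam_at_emb_eq_0_iff[of x p s t] by blast
  have ZZ: "D * (?Z * (?Z * x)) = D * (?Z * x)" for x
  proof -
    have "D * pev scal U.c (\<pi> a * \<pi> a - \<pi> a) = 0" by (rule U.pev_c_zero_mod[OF idem[OF a]])
    then have "D * (?Z * ?Z) = D * ?Z" by (simp add: U.PC.pev_diff U.PC.pev_mult right_diff_distrib)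
    then have "D * (?Z * ?Z) * x = D * ?Z * x" by (rule arg_cong)
    then show ?thesis by (simp only: mult.assoc)
  qed
  \<comment> \<open>A summand lies in the ideal of the idempotent z, so it has the form z y modulo
    the relations, and z z = z then gives that z fixes it.\<close>
  have unit: "D * (?Z * emb x) = D * emb x" if "x \<in> J1 \<or> x \<in> J2" for x
  proof -
    have "x \<in> {fa_add x y | x y. x \<in> J1 \<and> y \<in> J2}"
      using that zero by (metis (mono_tags, lifting) fa_add_zero(1,2) mem_Collect_eq)
    then obtain y where y: "x \<in> FA" "y \<in> FA" "fa_eq R x (fa_mult ?z y)"
      unfolding J(6) principal_ideal_def by blast
    then have "D * emb x = D * (?Z * emb y)"
      using fam_at_emb_eq_iff[of x "fa_mult ?z y" p s t] by (simp add: emb_mult Z)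
    moreover have "D * (?Z * emb x) = ?Z * (D * emb x)" by (rule U.d_left_commute[symmetric])
    ultimately show ?thesis using ZZ[of "emb y"] by (simp add: U.d_left_commute)
  qed
  have "fa_eq R ?z (fa_mult ?z fa_one)" by (simp add: fa_eq_def ideal_gen.zero)
  then have "?z \<in> principal_ideal R ?z"
    unfolding principal_ideal_def by (auto intro!: bexI[of _ fa_one])
  then obtain x1 x2 where x: "x1 \<in> J1" "x2 \<in> J2" "?z = fa_add x1 x2" using J(6) by blast
  then have xFA: "x1 \<in> FA" "x2 \<in> FA" using FA by auto
  have Zx: "?Z = emb x1 + emb x2" using x xFA Z by (simp add: emb_add)
  have proj1: "D * (emb x1 * emb y) = D * emb y" if "y \<in> J1" for y
  proof -
    have "y \<in> FA" using that FA by auto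
    then have "D * (emb x2 * emb y) = 0"
      using van[of "fa_mult x2 y"] mult that x xFA by (simp add: emb_mult)
    then show ?thesis using unit[of y] that unfolding Zx by (simp add: distrib_left distrib_right)
  qed
  have proj2: "D * (emb x1 * emb y) = 0" if "y \<in> J2" for y
  proof -
    have "y \<in> FA" using that FA by auto
    then show ?thesis using van[of "fa_mult x1 y"] mult that x xFA by (simp add: emb_mult)
  qed
  \<comment> \<open>The commutator of x1 with g is in J1 and, because x1 + x2 is central, equals
    minus the commutator of x2, which is in J2. Multiplication by x1 therefore both fixes it and
    kills it.\<close>
  have comm: "D * (emb x1 * emb g) = D * (emb g * emb x1)" if g: "g \<in> FA" for g
  proof -
    have m: "fa_sub (fa_mult x1 g) (fa_mult g x1) \<in> J1" "fa_sub (fa_mult x2 g) (fa_mult g x2) \<in> J2"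
      using sub mult x g by auto
    have "?Z * emb g = emb g * ?Z" by (rule U.pev_c_comm[OF emb_in_G[OF g]])
    then have eq: "emb x1 * emb g - emb g * emb x1 = - (emb x2 * emb g - emb g * emb x2)"
      unfolding Zx by (simp add: algebra_simps)
    let ?y = "emb x1 * emb g - emb g * emb x1"
    have "D * (emb x1 * ?y) = D * ?y"
      using proj1[OF m(1)] g xFA by (simp add: emb_sub emb_mult)
    moreover have "D * (emb x1 * (emb x2 * emb g - emb g * emb x2)) = 0"
      using proj2[OF m(2)] g xFA by (simp add: emb_sub emb_mult)
    then have "D * (emb x1 * ?y) = 0" unfolding eq by (simp only: mult_minus_right minus_zero)
    ultimately show ?thesis by (simp add: right_diff_distrib)
  qed
  have "D * emb w1 \<noteq> 0" using w1 FA fam_at_emb_eq_0_iff by blast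
  then obtain u1 l1 where u1: "u1 \<in> U.G" "U.hw l1 (D * (u1 * emb w1))" "D * (u1 * emb w1) \<noteq> 0" "l1 ^ p - l1 = s"
    by (rule U.ex_hw)
  have "D * emb w2 \<noteq> 0" using w2 FA fam_at_emb_eq_0_iff by blast
  then obtain u2 l2 where u2: "u2 \<in> U.G" "U.hw l2 (D * (u2 * emb w2))" "D * (u2 * emb w2) \<noteq> 0" "l2 ^ p - l2 = s"
    by (rule U.ex_hw)
  \<comment> \<open>The multiplier u1 comes from the free algebra, so the highest weight vector
    still belongs to J1 and x1 fixes it; the one from J2 is killed by x1.\<close>
  obtain y1 where y1: "y1 \<in> J1" "u1 * emb w1 = emb y1"
    using G_imp_emb[OF u1(1)] mult w1 FA emb_mult by (metis subsetD)
  obtain y2 where y2: "y2 \<in> J2" "u2 * emb w2 = emb y2"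
    using G_imp_emb[OF u2(1)] mult w2 FA emb_mult by (metis subsetD)
  note u1 = u1[unfolded y1(2)] and u2 = u2[unfolded y2(2)]
  have "?Z * (D * emb y1) = D * emb y1" "?Z * (D * emb y2) = D * emb y2"
    unfolding U.d_left_commute using unit y1 y2 by auto
  then have "(l1 + 1)\<^sup>2 = a" "(l2 + 1)\<^sup>2 = a"
    using hw_in_block_weight[OF a] u1 u2 by blast+
  then have linked: "(l1 + 1)\<^sup>2 = (l2 + 1)\<^sup>2" by simp
  have e1: "emb x1 * (D * emb y1) = D * emb y1" unfolding U.d_left_commute by (rule proj1[OF y1(1)])
  have e2: "emb x1 * (D * emb y2) = 0" unfolding U.d_left_commute by (rule proj2[OF y2(1)])
  show False
    by (rule U.linked_weights[OF emb_in_G[OF xFA(1)] comm[OF FA_gen] comm[OF FA_gen]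
          u1(2,3) e1 u1(4) u2(2,3) e2 u2(4) linked])
qed

lemma block_decomposition: "is_block_decomposition R S (\<lambda>a. fa_of_poly (\<pi> a))"
  unfolding is_block_decomposition_def
proof (intro conjI ballI impI allI)
  show "finite S" by (rule finite_S)
  show "central_idem R (fa_of_poly (\<pi> a))" if a: "a \<in> S" for a
    unfolding central_idem_def
  proof (intro conjI ballI)
    show "fa_eq R (fa_mult (fa_of_poly (\<pi> a)) x) (fa_mult x (fa_of_poly (\<pi> a)))" if "x \<in> FA" for x
      using that U.pev_c_comm[OF emb_in_G[OF that]]
      by (subst fam_at_emb_eq_iff[symmetric]) (simp_all add: emb_mult emb_of_poly)
    have "D * pev scal U.c (\<pi> a * \<pi> a - \<pi> a) = 0" by (rule U.pev_c_zero_mod[OF idem[OF a]])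
    then show "fa_eq R (fa_mult (fa_of_poly (\<pi> a)) (fa_of_poly (\<pi> a))) (fa_of_poly (\<pi> a))"
      by (subst fam_at_emb_eq_iff[symmetric])
        (simp_all add: emb_mult emb_of_poly U.PC.pev_diff U.PC.pev_mult right_diff_distrib)
  qed simp
  show "fa_eq R (fa_mult (fa_of_poly (\<pi> a)) (fa_of_poly (\<pi> b))) fa_zero" if "a \<in> S" "b \<in> S" "a \<noteq> b" for a b
    using U.pev_c_zero_mod[OF orth[OF that]]
    by (subst fam_at_emb_eq_iff[symmetric]) (simp_all add: emb_mult emb_of_poly U.PC.pev_mult)
  show "fa_eq R (fa_setsum S (\<lambda>a. fa_of_poly (\<pi> a))) fa_one"
    using U.pev_c_zero_mod[OF sum_one] finite_S
    by (subst fam_at_emb_eq_iff[symmetric])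
      (simp_all add: FA_setsum emb_setsum emb_of_poly U.PC.pev_diff U.PC.pev_sum right_diff_distrib)
  show "is_block R (fa_of_poly (\<pi> a))" if a: "a \<in> S" for a
    unfolding is_block_def using idempotent_not_in_ideal[OF a] block_indecomposable[OF a] by blast
  show "fa_act m \<rho> casimir = a \<cdot>\<^sub>m 1\<^sub>m m"
    if a: "a \<in> S" and m: "simple_module R m \<rho> \<and> fa_act m \<rho> (fa_of_poly (\<pi> a)) \<noteq> 0\<^sub>m m m" for a m \<rho>
  proof (rule simple_module_scalar[OF _ sl2_rels_FA FA_casimir _ FA_of_poly])
    show "simple_module R m \<rho>" "fa_act m \<rho> (fa_of_poly (\<pi> a)) \<noteq> 0\<^sub>m m m" using m by auto
    show "fa_sub (fa_mult casimir (fa_gen g)) (fa_mult (fa_gen g) casimir) \<in> ideal_gen R" for g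
      using U.G_comm_c[OF emb_in_G[OF FA_gen[of g]]]
      by (subst fam_at_emb_eq_0_iff[symmetric]) (simp_all add: emb_mult emb_sub emb_casimir)
    have "D * pev scal U.c ([:-a, 1:] * ([:-a, 1:] * \<pi> a)) = 0"
      using U.pev_c_zero_mod[OF square_annihilates[OF a]] by (simp only: power2_eq_square mult.assoc)
    moreover have "pev scal U.c [:-a, 1:] = U.c - scal a"
      by (simp add: U.PC.pev_pCons U.sc_minus U.sc_one)
    ultimately have "D * ((U.c - scal a) * ((U.c - scal a) * pev scal U.c (\<pi> a))) = 0"
      by (simp only: U.PC.pev_mult)
    then show "fa_mult (fa_sub casimir (fa_const a)) (fa_mult (fa_sub casimir (fa_const a)) (fa_of_poly (\<pi> a))) \<in> ideal_gen R"
      by (subst fam_at_emb_eq_0_iff[symmetric]) (simp_all add: emb_mult emb_sub emb_casimir emb_of_poly)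
  qed
qed

end

end

theorem theorem4p2:
  fixes p :: nat
  assumes "prime p" and "p > 2" and "CHAR('k::field) = p" and "alg_closed TYPE('k)"
  shows "[:0, 1:] dvd (Phi p :: 'k poly)
      \<and> (\<forall>\<alpha>::'k\<in>qr_index p. \<alpha> \<noteq> 0 \<longrightarrow> [:-\<alpha>, 1:] ^ 2 dvd Polynomial.smult 2 ([:\<alpha>, 1:] * Phi p))
      \<and> (\<forall>t\<in>{0, 1::'k}.
           is_block_decomposition (sl2_rels p 0 t) (qr_index p) (\<lambda>\<alpha>. fa_of_poly (pi_res p \<alpha>)))
      \<and> (\<forall>a::'k. a \<noteq> 0 \<longrightarrow>
           (\<forall>\<alpha>. poly (Phi_a p a) \<alpha> = 0 \<longrightarrow> poly (pi_a p a \<alpha>) \<alpha> = 1)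
         \<and> is_block_decomposition (sl2_rels p a 0) {\<alpha>. poly (Phi_a p a) \<alpha> = 0}
             (\<lambda>\<alpha>. fa_of_poly (pi_a p a \<alpha>)))"
proof (intro conjI ballI impI allI)
  note p = assms(1-3)
  show "[:0, 1:] dvd (Phi p :: 'k poly)" unfolding Phi_factor[OF p] by (rule dvd_triv_left)
  show "[:-\<alpha>, 1:] ^ 2 dvd Polynomial.smult 2 ([:\<alpha>, 1:] * Phi p)" if "\<alpha> \<in> qr_index p" "\<alpha> \<noteq> 0" for \<alpha> :: 'k
    using that qr_poly_split[OF p, of \<alpha>] unfolding qr_index_eq[OF p] by (metis dvd_triv_left insert_iff)
  \<comment> \<open>With s = 0 the modulus Phi - s^2 is Phi itself, and the argument is uniform in
    t.\<close>
  show "is_block_decomposition (sl2_rels p 0 t) (qr_index p) (\<lambda>\<alpha>. fa_of_poly (pi_res p \<alpha>))" for t :: 'k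
    by (rule block_decomposition[OF p assms(4)])
      (use crt_nilpotent[OF p] qr_index_weight[OF p] in simp_all)
  fix a :: 'k assume a: "a \<noteq> 0"
  note crt = crt_semisimple[OF p a assms(4)]
  show "poly (pi_a p a \<alpha>) \<alpha> = 1" if "poly (Phi_a p a) \<alpha> = 0" for \<alpha>
    using crt_system.eval_one[OF crt] that by simp
  show "is_block_decomposition (sl2_rels p a 0) {\<alpha>. poly (Phi_a p a) \<alpha> = 0} (\<lambda>\<alpha>. fa_of_poly (pi_a p a \<alpha>))"
    by (rule block_decomposition[OF p assms(4) crt[unfolded Phi_a_def[of p a]], folded Phi_a_def])
      (use Phi_a_weight[OF p a assms(4)] in simp)
qed

end
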